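(* Let $M$ be a smooth compact orientable surface of genus $g>1$ (with a fixed orientation). Fix a pair $(J,B)$ with $J$ a complex structure on $M$ inducing the orientation and $B$ the real part of a $J$-holomorphic cubic differential, $B$ not identically zero. For $t\ge 0$, let ${}^th$ be the Gauduchon metric, normalized so that $\mathsf R_{{}^th}=-2$, of the unique Einstein AH structure $\Psi^{-1}(J,e^{3t}B)$ associated to $(J,e^{3t}B)$. Write $h={}^1h$ and ${}^th=e^{\phi_t}h$. Then $\phi_t$ is pointwise non-decreasing and Lipschitz as a function of $t\in(0,\infty)$, with Lipschitz constant $2$.
   Context: A projective structure $[\nabla]$ is a class of torsion-free affine connections with the same unparametrized geodesics. An AH structure on a surface is a pair $([\nabla],[h])$ of a projective structure and a (here Riemannian) conformal structure. Let $H_{ij}=|\det h|^{-1/2}h_{ij}$ (independent of $h\in[h]$), with inverse $H^{ij}$. The aligned representative is the unique torsion-free $\nabla\in[\nabla]$ with $\nabla_{[i}H_{j]k}=0$; henceforth $\nabla$ denotes it. The cubic torsion is given by $\mathcal L_{ij}{}^pH_{pk}=\nabla_iH_{jk}$. Curvature: $2\nabla_{[i}\nabla_{j]}X^k=R_{ijp}{}^kX^p$, $R_{ij}=R_{pij}{}^p$, $R=H^{ij}R_{ij}$, $\mathsf R_h=h^{ij}R_{ij}$, $F_{ij}=-R_{[ij]}$. The AH structure is Einstein if $R_{(ij)}=\tfrac12RH_{ij}$ and $\nabla_iR+2H^{pq}\nabla_qF_{ip}=0$. A metric $h\in[h]$ with $\nabla|\det h|=0$ is called distinguished (unique up to positive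 constant if it exists, in which case the AH structure is exact); for exact structures the Gauduchon metrics are exactly the distinguished metrics. On a compact oriented surface of genus $>1$ every Riemannian Einstein AH structure is exact with $\mathsf R_h$ a negative constant for $h$ distinguished, and the map $\Psi([\nabla],[h])=(J,B)$, with $J$ determined by $[h]$ and the orientation and $B_{ijk}=\mathcal L_{ij}{}^ph_{pk}$ for the unique distinguished $h\in[h]$ with $\mathsf R_h=-2$, is a bijection from such structures onto pairs $(J,B)$ with $B$ the real part of a $J$-holomorphic cubic differential. *)

theory Defs
  imports "HOL-Analysis.Analysis" "HOL-Homology.Homology"
begin

section \<open>Smooth surfaces\<close>

text \<open>\<open>ck_on k f S\<close> is meant for open \<open>S\<close>: the Frechet derivatives are not relative to \<open>S\<close>.\<close>

fun ck_on :: "nat \<Rightarrow> ('a::real_normed_vector \<Rightarrow> 'b::real_normed_vector) \<Rightarrow> 'a set \<Rightarrow> bool" where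
  "ck_on 0 f S \<longleftrightarrow> continuous_on S f"
| "ck_on (Suc k) f S \<longleftrightarrow> (\<forall>x\<in>S. f differentiable (at x)) \<and>
     (\<forall>v. ck_on k (\<lambda>x. frechet_derivative f (at x) v) S)"

definition smooth_on :: "('a::real_normed_vector \<Rightarrow> 'b::real_normed_vector) \<Rightarrow> 'a set \<Rightarrow> bool" where
  "smooth_on f S \<longleftrightarrow> (\<forall>k. ck_on k f S)"

text \<open>A chart is a pair of a domain and a coordinate map; values of the coordinate map
  off the domain carry no meaning.\<close>

type_synonym 'a chart = "'a set \<times> ('a \<Rightarrow> real^2)"

definition param :: "'a chart \<Rightarrow> real^2 \<Rightarrow> 'a" where
  "param \<kappa> = inv_into (fst \<kappa>) (snd \<kappa>)"

definition is_chart :: "'a topology \<Rightarrow> 'a chart \<Rightarrow> bool" where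
  "is_chart X \<kappa> \<longleftrightarrow> openin X (fst \<kappa>) \<and> open (snd \<kappa> ` fst \<kappa>) \<and>
     homeomorphic_map (subtopology X (fst \<kappa>)) (top_of_set (snd \<kappa> ` fst \<kappa>)) (snd \<kappa>)"

definition compatible :: "'a chart \<Rightarrow> 'a chart \<Rightarrow> bool" where
  "compatible \<kappa> \<kappa>' \<longleftrightarrow>
     smooth_on (snd \<kappa>' \<circ> param \<kappa>) (snd \<kappa> ` (fst \<kappa> \<inter> fst \<kappa>')) \<and>
     smooth_on (snd \<kappa> \<circ> param \<kappa>') (snd \<kappa>' ` (fst \<kappa> \<inter> fst \<kappa>'))"

text \<open>A smooth surface is a space with a maximal smooth two-dimensional atlas \<open>A\<close>.\<close>

definition smooth_surface :: "'a topology \<Rightarrow> 'a chart set \<Rightarrow> bool" where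
  "smooth_surface X A \<longleftrightarrow> Hausdorff_space X \<and> second_countable X \<and>
     (\<forall>\<kappa>\<in>A. is_chart X \<kappa>) \<and> (\<Union>\<kappa>\<in>A. fst \<kappa>) = topspace X \<and>
     (\<forall>\<kappa>\<in>A. \<forall>\<kappa>'\<in>A. compatible \<kappa> \<kappa>') \<and>
     (\<forall>\<kappa>. is_chart X \<kappa> \<and> (\<forall>\<kappa>'\<in>A. compatible \<kappa> \<kappa>') \<longrightarrow> \<kappa> \<in> A)"

text \<open>\<open>pd \<kappa> i f p\<close> is \<open>\<partial>f/\<partial>x\<^sup>i\<close> at \<open>p\<close> in the coordinates of \<open>\<kappa>\<close>, and
  \<open>jac \<kappa> \<kappa>' p $ i $ a\<close> is \<open>\<partial>y\<^sup>a/\<partial>x\<^sup>i\<close> for the coordinates \<open>x\<close> of \<open>\<kappa>\<close> and \<open>y\<close> of \<open>\<kappa>'\<close>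
  (the transpose of the usual Jacobian matrix).\<close>

definition pd :: "'a chart \<Rightarrow> 2 \<Rightarrow> ('a \<Rightarrow> real) \<Rightarrow> 'a \<Rightarrow> real" where
  "pd \<kappa> i f p = frechet_derivative (\<lambda>x. f (param \<kappa> x)) (at (snd \<kappa> p)) (axis i 1)"

definition jac :: "'a chart \<Rightarrow> 'a chart \<Rightarrow> 'a \<Rightarrow> real^2^2" where
  "jac \<kappa> \<kappa>' p = (\<chi> i a. pd \<kappa> i (\<lambda>q. snd \<kappa>' q $ a) p)"

text \<open>An orientation is a maximal oriented subatlas \<open>Or\<close> of \<open>A\<close>.\<close>

definition orientation :: "'a topology \<Rightarrow> 'a chart set \<Rightarrow> 'a chart set \<Rightarrow> bool" where
  "orientation X A Or \<longleftrightarrow> Or \<subseteq> A \<and> (\<Union>\<kappa>\<in>Or. fst \<kappa>) = topspace X \<and>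
     (\<forall>\<kappa>\<in>Or. \<forall>\<kappa>'\<in>Or. \<forall>p\<in>fst \<kappa> \<inter> fst \<kappa>'. det (jac \<kappa> \<kappa>' p) > 0) \<and>
     (\<forall>\<kappa>\<in>A. (\<forall>\<kappa>'\<in>Or. \<forall>p\<in>fst \<kappa> \<inter> fst \<kappa>'. det (jac \<kappa> \<kappa>' p) > 0) \<longrightarrow> \<kappa> \<in> Or)"

text \<open>The genus of a closed connected orientable surface is half the rank of its
  first integral homology, which is free abelian.\<close>

definition has_genus :: "'a topology \<Rightarrow> nat \<Rightarrow> bool" where
  "has_genus X g \<longleftrightarrow> homology_group 1 X \<cong> free_Abelian_group {..<2 * g}"


section \<open>Tensor fields and connections\<close>

text \<open>A field assigns to each chart its component functions on the domain of that chart.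
  The tensor types are fixed by the transformation laws.  Components are indexed in the
  order of the abstract indices, so that \<open>J $ i $ j\<close> is \<open>J\<^sub>i\<^sup>j\<close>, i.e.
  \<open>J \<partial>\<^sub>i = \<Sum>\<^sub>j J\<^sub>i\<^sup>j \<partial>\<^sub>j\<close>, and \<open>N $ i $ j $ k\<close> is the Christoffel symbol
  \<open>\<Gamma>\<^sub>i\<^sub>j\<^sup>k\<close>, i.e. \<open>\<nabla>\<^sub>i \<partial>\<^sub>j = \<Sum>\<^sub>k \<Gamma>\<^sub>i\<^sub>j\<^sup>k \<partial>\<^sub>k\<close>.\<close>

type_synonym ('a, 'b) field = "'a chart \<Rightarrow> 'a \<Rightarrow> 'b"

definition smooth_field :: "'a chart set \<Rightarrow> ('a, 'b::real_normed_vector) field \<Rightarrow> bool" where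
  "smooth_field A T \<longleftrightarrow> (\<forall>\<kappa>\<in>A. smooth_on (\<lambda>x. T \<kappa> (param \<kappa> x)) (snd \<kappa> ` fst \<kappa>))"

definition riemannian_metric :: "'a chart set \<Rightarrow> ('a, real^2^2) field \<Rightarrow> bool" where
  "riemannian_metric A h \<longleftrightarrow> smooth_field A h \<and>
     (\<forall>\<kappa>\<in>A. \<forall>\<kappa>'\<in>A. \<forall>p\<in>fst \<kappa> \<inter> fst \<kappa>'. \<forall>i j. h \<kappa> p $ i $ j =
        (\<Sum>a\<in>UNIV. \<Sum>b\<in>UNIV. jac \<kappa> \<kappa>' p $ i $ a * jac \<kappa> \<kappa>' p $ j $ b * h \<kappa>' p $ a $ b)) \<and>
     (\<forall>\<kappa>\<in>A. \<forall>p\<in>fst \<kappa>. transpose (h \<kappa> p) = h \<kappa> p \<and>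
        (\<forall>v. v \<noteq> 0 \<longrightarrow> v \<bullet> (h \<kappa> p *v v) > 0))"

definition cubic_tensor :: "'a chart set \<Rightarrow> ('a, real^2^2^2) field \<Rightarrow> bool" where
  "cubic_tensor A B \<longleftrightarrow> smooth_field A B \<and>
     (\<forall>\<kappa>\<in>A. \<forall>\<kappa>'\<in>A. \<forall>p\<in>fst \<kappa> \<inter> fst \<kappa>'. \<forall>i j k. B \<kappa> p $ i $ j $ k =
        (\<Sum>a\<in>UNIV. \<Sum>b\<in>UNIV. \<Sum>c\<in>UNIV. jac \<kappa> \<kappa>' p $ i $ a * jac \<kappa> \<kappa>' p $ j $ b *
           jac \<kappa> \<kappa>' p $ k $ c * B \<kappa>' p $ a $ b $ c))"

definition torsion_free_connection :: "'a chart set \<Rightarrow> ('a, real^2^2^2) field \<Rightarrow> bool" where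
  "torsion_free_connection A N \<longleftrightarrow> smooth_field A N \<and>
     (\<forall>\<kappa>\<in>A. \<forall>\<kappa>'\<in>A. \<forall>p\<in>fst \<kappa> \<inter> fst \<kappa>'. \<forall>i j c.
        (\<Sum>k\<in>UNIV. N \<kappa> p $ i $ j $ k * jac \<kappa> \<kappa>' p $ k $ c) =
        pd \<kappa> i (\<lambda>q. jac \<kappa> \<kappa>' q $ j $ c) p +
        (\<Sum>a\<in>UNIV. \<Sum>b\<in>UNIV. jac \<kappa> \<kappa>' p $ i $ a * jac \<kappa> \<kappa>' p $ j $ b * N \<kappa>' p $ a $ b $ c)) \<and>
     (\<forall>\<kappa>\<in>A. \<forall>p\<in>fst \<kappa>. \<forall>i j k. N \<kappa> p $ i $ j $ k = N \<kappa> p $ j $ i $ k)"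


section \<open>Complex structures and holomorphic cubic differentials\<close>

definition holo_chart :: "('a, real^2^2) field \<Rightarrow> 'a chart \<Rightarrow> bool" where
  "holo_chart J \<kappa> \<longleftrightarrow> (\<forall>p\<in>fst \<kappa>. J \<kappa> p $ 1 $ 1 = 0 \<and> J \<kappa> p $ 1 $ 2 = 1 \<and>
     J \<kappa> p $ 2 $ 1 = -1 \<and> J \<kappa> p $ 2 $ 2 = 0)"

text \<open>A complex structure is an integrable almost complex structure: the surface is covered
  by coordinates \<open>z = x\<^sup>1 + i x\<^sup>2\<close> with \<open>J \<partial>\<^sub>1 = \<partial>\<^sub>2\<close>, \<open>J \<partial>\<^sub>2 = - \<partial>\<^sub>1\<close>.\<close>

definition complex_structure :: "'a topology \<Rightarrow> 'a chart set \<Rightarrow> ('a, real^2^2) field \<Rightarrow> bool" where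
  "complex_structure X A J \<longleftrightarrow> smooth_field A J \<and>
     (\<forall>\<kappa>\<in>A. \<forall>\<kappa>'\<in>A. \<forall>p\<in>fst \<kappa> \<inter> fst \<kappa>'. J \<kappa> p ** jac \<kappa> \<kappa>' p = jac \<kappa> \<kappa>' p ** J \<kappa>' p) \<and>
     (\<forall>\<kappa>\<in>A. \<forall>p\<in>fst \<kappa>. J \<kappa> p ** J \<kappa> p = - mat 1) \<and>
     (\<forall>p\<in>topspace X. \<exists>\<kappa>\<in>A. p \<in> fst \<kappa> \<and> holo_chart J \<kappa>)"

text \<open>The pair \<open>\<partial>\<^sub>1, J \<partial>\<^sub>1\<close> is positively oriented exactly if \<open>J\<^sub>1\<^sup>2 > 0\<close>.\<close>

definition induces_orientation :: "'a chart set \<Rightarrow> ('a, real^2^2) field \<Rightarrow> bool" where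
  "induces_orientation Or J \<longleftrightarrow> (\<forall>\<kappa>\<in>Or. \<forall>p\<in>fst \<kappa>. J \<kappa> p $ 1 $ 2 > 0)"

definition to_complex :: "real^2 \<Rightarrow> complex" where
  "to_complex x = Complex (x $ 1) (x $ 2)"

definition of_complex :: "complex \<Rightarrow> real^2" where
  "of_complex z = vector [Re z, Im z]"

text \<open>A holomorphic cubic differential is given in each holomorphic coordinate \<open>z\<close> by
  \<open>f(z) dz\<^sup>3\<close> with \<open>f\<close> holomorphic; \<open>Q \<kappa>\<close> is the coefficient \<open>f\<close> as a function on the
  domain of \<open>\<kappa>\<close>.\<close>

definition holomorphic_cubic_differential ::
  "'a chart set \<Rightarrow> ('a, real^2^2) field \<Rightarrow> ('a, complex) field \<Rightarrow> bool" where
  "holomorphic_cubic_differential A J Q \<longleftrightarrow>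
     (\<forall>\<kappa>\<in>A. holo_chart J \<kappa> \<longrightarrow>
        (\<lambda>z. Q \<kappa> (param \<kappa> (of_complex z))) holomorphic_on (to_complex ` snd \<kappa> ` fst \<kappa>)) \<and>
     (\<forall>\<kappa>\<in>A. \<forall>\<kappa>'\<in>A. holo_chart J \<kappa> \<and> holo_chart J \<kappa>' \<longrightarrow>
        (\<forall>p\<in>fst \<kappa> \<inter> fst \<kappa>'. Q \<kappa> p = Q \<kappa>' p *
           deriv (\<lambda>z. to_complex (snd \<kappa>' (param \<kappa> (of_complex z)))) (to_complex (snd \<kappa> p)) ^ 3))"

text \<open>The components of \<open>dz = dx\<^sup>1 + i dx\<^sup>2\<close>.\<close>

definition dz :: "2 \<Rightarrow> complex" where
  "dz i = (if i = 1 then 1 else \<i>)"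

definition real_part_of_cubic_differential ::
  "'a chart set \<Rightarrow> ('a, real^2^2) field \<Rightarrow> ('a, real^2^2^2) field \<Rightarrow> bool" where
  "real_part_of_cubic_differential A J B \<longleftrightarrow> cubic_tensor A B \<and>
     (\<exists>Q. holomorphic_cubic_differential A J Q \<and>
        (\<forall>\<kappa>\<in>A. holo_chart J \<kappa> \<longrightarrow> (\<forall>p\<in>fst \<kappa>. \<forall>i j k.
           B \<kappa> p $ i $ j $ k = Re (Q \<kappa> p * dz i * dz j * dz k))))"


section \<open>AH structures\<close>

text \<open>A regular curve on an open interval is an unparametrized geodesic (a geodesic up to
  reparametrization) if its acceleration is everywhere a multiple of its velocity.\<close>

definition unparametrized_geodesic ::
  "'a topology \<Rightarrow> 'a chart set \<Rightarrow> ('a, real^2^2^2) field \<Rightarrow> real \<Rightarrow> real \<Rightarrow> (real \<Rightarrow> 'a) \<Rightarrow> bool" where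
  "unparametrized_geodesic X A N a b \<gamma> \<longleftrightarrow>
     continuous_map (top_of_set {a<..<b}) X \<gamma> \<and>
     (\<forall>\<kappa>\<in>A. smooth_on (snd \<kappa> \<circ> \<gamma>) {s\<in>{a<..<b}. \<gamma> s \<in> fst \<kappa>}) \<and>
     (\<forall>\<kappa>\<in>A. \<forall>s\<in>{a<..<b}. \<gamma> s \<in> fst \<kappa> \<longrightarrow>
        (let v = (\<lambda>r. vector_derivative (snd \<kappa> \<circ> \<gamma>) (at r)) in
           v s \<noteq> 0 \<and>
           (\<exists>c. \<forall>k. vector_derivative v (at s) $ k +
              (\<Sum>i\<in>UNIV. \<Sum>j\<in>UNIV. N \<kappa> (\<gamma> s) $ i $ j $ k * v s $ i * v s $ j) = c * v s $ k)))"

definition projective_structure ::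
  "'a topology \<Rightarrow> 'a chart set \<Rightarrow> ('a, real^2^2^2) field set \<Rightarrow> bool" where
  "projective_structure X A P \<longleftrightarrow> (\<exists>N. torsion_free_connection A N \<and>
     P = {N'. torsion_free_connection A N' \<and> (\<forall>a b \<gamma>.
        unparametrized_geodesic X A N' a b \<gamma> \<longleftrightarrow> unparametrized_geodesic X A N a b \<gamma>)})"

definition conformal_structure :: "'a chart set \<Rightarrow> ('a, real^2^2) field set \<Rightarrow> bool" where
  "conformal_structure A C \<longleftrightarrow> (\<exists>h. riemannian_metric A h \<and>
     C = {h'. riemannian_metric A h' \<and>
        (\<exists>f. \<forall>\<kappa>\<in>A. \<forall>p\<in>fst \<kappa>. h' \<kappa> p = exp (f p) *\<^sub>R h \<kappa> p)})"

definition AH_structure :: "'a topology \<Rightarrow> 'a chart set \<Rightarrow>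
    ('a, real^2^2^2) field set \<Rightarrow> ('a, real^2^2) field set \<Rightarrow> bool" where
  "AH_structure X A P C \<longleftrightarrow> projective_structure X A P \<and> conformal_structure A C"

text \<open>\<open>H\<^sub>i\<^sub>j = |det h|\<^sup>-\<^sup>1\<^sup>/\<^sup>2 h\<^sub>i\<^sub>j\<close> and its inverse \<open>H\<^sup>i\<^sup>j\<close>.\<close>

definition Hl :: "('a, real^2^2) field \<Rightarrow> ('a, real^2^2) field" where
  "Hl h \<kappa> p = (\<bar>det (h \<kappa> p)\<bar> powr (-1/2)) *\<^sub>R h \<kappa> p"

definition Hu :: "('a, real^2^2) field \<Rightarrow> ('a, real^2^2) field" where
  "Hu h \<kappa> p = matrix_inv (Hl h \<kappa> p)"

text \<open>A torsion-free \<open>\<nabla>\<close> acts on \<open>|det h|\<close>, which transforms as the square of an area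
  density, by \<open>\<nabla>\<^sub>i|det h| = \<partial>\<^sub>i|det h| - 2 \<Gamma>\<^sub>i\<^sub>p\<^sup>p |det h|\<close>.  Hence weighted tensors
  such as \<open>H\<^sub>i\<^sub>j\<close> (a tensor times \<open>|det h|\<^sup>-\<^sup>1\<^sup>/\<^sup>2\<close>) and \<open>R = H\<^sup>i\<^sup>jR\<^sub>i\<^sub>j\<close> (a function times
  \<open>|det h|\<^sup>1\<^sup>/\<^sup>2\<close>) contribute the trace terms \<open>+\<Gamma>\<^sub>i\<^sub>p\<^sup>p\<close> and \<open>-\<Gamma>\<^sub>i\<^sub>p\<^sup>p\<close> below.\<close>

definition trace_conn :: "('a, real^2^2^2) field \<Rightarrow> 'a chart \<Rightarrow> 'a \<Rightarrow> 2 \<Rightarrow> real" where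
  "trace_conn N \<kappa> p i = (\<Sum>m\<in>UNIV. N \<kappa> p $ i $ m $ m)"

definition nabla_H :: "('a, real^2^2^2) field \<Rightarrow> ('a, real^2^2) field \<Rightarrow>
    'a chart \<Rightarrow> 'a \<Rightarrow> 2 \<Rightarrow> 2 \<Rightarrow> 2 \<Rightarrow> real" where
  "nabla_H N h \<kappa> p i j k = pd \<kappa> i (\<lambda>q. Hl h \<kappa> q $ j $ k) p
     - (\<Sum>m\<in>UNIV. N \<kappa> p $ i $ j $ m * Hl h \<kappa> p $ m $ k)
     - (\<Sum>m\<in>UNIV. N \<kappa> p $ i $ k $ m * Hl h \<kappa> p $ j $ m)
     + trace_conn N \<kappa> p i * Hl h \<kappa> p $ j $ k"

definition aligned_representative :: "'a chart set \<Rightarrow> ('a, real^2^2^2) field set \<Rightarrow>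
    ('a, real^2^2) field set \<Rightarrow> ('a, real^2^2^2) field \<Rightarrow> bool" where
  "aligned_representative A P C N \<longleftrightarrow> N \<in> P \<and>
     (\<forall>h\<in>C. \<forall>\<kappa>\<in>A. \<forall>p\<in>fst \<kappa>. \<forall>i j k. nabla_H N h \<kappa> p i j k = nabla_H N h \<kappa> p j i k)"

text \<open>\<open>\<L>\<^sub>i\<^sub>j\<^sup>k\<close>, obtained from \<open>\<L>\<^sub>i\<^sub>j\<^sup>pH\<^sub>p\<^sub>k = \<nabla>\<^sub>iH\<^sub>j\<^sub>k\<close> by raising an index.\<close>

definition cubic_torsion :: "('a, real^2^2^2) field \<Rightarrow> ('a, real^2^2) field \<Rightarrow>
    'a chart \<Rightarrow> 'a \<Rightarrow> 2 \<Rightarrow> 2 \<Rightarrow> 2 \<Rightarrow> real" where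
  "cubic_torsion N h \<kappa> p i j k = (\<Sum>m\<in>UNIV. nabla_H N h \<kappa> p i j m * Hu h \<kappa> p $ m $ k)"

text \<open>\<open>R\<^sub>i\<^sub>j\<^sub>k\<^sup>l\<close>, with \<open>2\<nabla>\<^sub>[\<^sub>i\<nabla>\<^sub>j\<^sub>]X\<^sup>l = R\<^sub>i\<^sub>j\<^sub>k\<^sup>l X\<^sup>k\<close>.\<close>

definition curvature :: "('a, real^2^2^2) field \<Rightarrow> 'a chart \<Rightarrow> 'a \<Rightarrow>
    2 \<Rightarrow> 2 \<Rightarrow> 2 \<Rightarrow> 2 \<Rightarrow> real" where
  "curvature N \<kappa> p i j k l =
     pd \<kappa> i (\<lambda>q. N \<kappa> q $ j $ k $ l) p - pd \<kappa> j (\<lambda>q. N \<kappa> q $ i $ k $ l) p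
     + (\<Sum>m\<in>UNIV. N \<kappa> p $ i $ m $ l * N \<kappa> p $ j $ k $ m - N \<kappa> p $ j $ m $ l * N \<kappa> p $ i $ k $ m)"

definition ricci :: "('a, real^2^2^2) field \<Rightarrow> 'a chart \<Rightarrow> 'a \<Rightarrow> 2 \<Rightarrow> 2 \<Rightarrow> real" where
  "ricci N \<kappa> p i j = (\<Sum>m\<in>UNIV. curvature N \<kappa> p m i j m)"

definition faraday :: "('a, real^2^2^2) field \<Rightarrow> 'a chart \<Rightarrow> 'a \<Rightarrow> 2 \<Rightarrow> 2 \<Rightarrow> real" where
  "faraday N \<kappa> p i j = - (ricci N \<kappa> p i j - ricci N \<kappa> p j i) / 2"

text \<open>The weighted scalar curvature \<open>R = H\<^sup>i\<^sup>jR\<^sub>i\<^sub>j\<close> and the function \<open>h\<^sup>i\<^sup>jR\<^sub>i\<^sub>j\<close>.\<close>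

definition weighted_scalar :: "('a, real^2^2^2) field \<Rightarrow> ('a, real^2^2) field \<Rightarrow>
    'a chart \<Rightarrow> 'a \<Rightarrow> real" where
  "weighted_scalar N h \<kappa> p = (\<Sum>i\<in>UNIV. \<Sum>j\<in>UNIV. Hu h \<kappa> p $ i $ j * ricci N \<kappa> p i j)"

definition scalar_curvature :: "('a, real^2^2^2) field \<Rightarrow> ('a, real^2^2) field \<Rightarrow>
    'a chart \<Rightarrow> 'a \<Rightarrow> real" where
  "scalar_curvature N h \<kappa> p = (\<Sum>i\<in>UNIV. \<Sum>j\<in>UNIV. matrix_inv (h \<kappa> p) $ i $ j * ricci N \<kappa> p i j)"

text \<open>\<open>\<nabla>\<^sub>iR\<close> and \<open>\<nabla>\<^sub>iF\<^sub>j\<^sub>k\<close>.\<close>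

definition nabla_weighted_scalar :: "('a, real^2^2^2) field \<Rightarrow> ('a, real^2^2) field \<Rightarrow>
    'a chart \<Rightarrow> 'a \<Rightarrow> 2 \<Rightarrow> real" where
  "nabla_weighted_scalar N h \<kappa> p i =
     pd \<kappa> i (weighted_scalar N h \<kappa>) p - trace_conn N \<kappa> p i * weighted_scalar N h \<kappa> p"

definition nabla_faraday :: "('a, real^2^2^2) field \<Rightarrow> 'a chart \<Rightarrow> 'a \<Rightarrow> 2 \<Rightarrow> 2 \<Rightarrow> 2 \<Rightarrow> real" where
  "nabla_faraday N \<kappa> p i j k = pd \<kappa> i (\<lambda>q. faraday N \<kappa> q j k) p
     - (\<Sum>m\<in>UNIV. N \<kappa> p $ i $ j $ m * faraday N \<kappa> p m k)
     - (\<Sum>m\<in>UNIV. N \<kappa> p $ i $ k $ m * faraday N \<kappa> p j m)"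

text \<open>In the following, \<open>N\<close> is the aligned representative of the AH structure \<open>(P, C)\<close>.\<close>

definition einstein_AH :: "'a topology \<Rightarrow> 'a chart set \<Rightarrow> ('a, real^2^2^2) field set \<Rightarrow>
    ('a, real^2^2) field set \<Rightarrow> ('a, real^2^2^2) field \<Rightarrow> bool" where
  "einstein_AH X A P C N \<longleftrightarrow> AH_structure X A P C \<and> aligned_representative A P C N \<and>
     (\<forall>h\<in>C. \<forall>\<kappa>\<in>A. \<forall>p\<in>fst \<kappa>.
        (\<forall>i j. (ricci N \<kappa> p i j + ricci N \<kappa> p j i) / 2 =
           weighted_scalar N h \<kappa> p / 2 * Hl h \<kappa> p $ i $ j) \<and>
        (\<forall>i. nabla_weighted_scalar N h \<kappa> p i +
           2 * (\<Sum>a\<in>UNIV. \<Sum>b\<in>UNIV. Hu h \<kappa> p $ a $ b * nabla_faraday N \<kappa> p b i a) = 0))"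

text \<open>A metric \<open>h\<close> of the conformal class is distinguished if \<open>\<nabla>|det h| = 0\<close>.  An AH
  structure that has such a metric is exact, and then the Gauduchon metrics are exactly
  the distinguished ones.\<close>

definition distinguished_metric :: "'a chart set \<Rightarrow> ('a, real^2^2) field set \<Rightarrow>
    ('a, real^2^2^2) field \<Rightarrow> ('a, real^2^2) field \<Rightarrow> bool" where
  "distinguished_metric A C N h \<longleftrightarrow> h \<in> C \<and>
     (\<forall>\<kappa>\<in>A. \<forall>p\<in>fst \<kappa>. \<forall>i. pd \<kappa> i (\<lambda>q. \<bar>det (h \<kappa> q)\<bar>) p -
        2 * trace_conn N \<kappa> p i * \<bar>det (h \<kappa> p)\<bar> = 0)"

definition normalized_gauduchon_metric :: "'a chart set \<Rightarrow> ('a, real^2^2) field set \<Rightarrow>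
    ('a, real^2^2^2) field \<Rightarrow> ('a, real^2^2) field \<Rightarrow> bool" where
  "normalized_gauduchon_metric A C N h \<longleftrightarrow> distinguished_metric A C N h \<and>
     (\<forall>\<kappa>\<in>A. \<forall>p\<in>fst \<kappa>. scalar_curvature N h \<kappa> p = -2)"

text \<open>The complex structure determined by a conformal structure and an orientation:
  \<open>J\<^sub>i\<^sup>pJ\<^sub>j\<^sup>qh\<^sub>p\<^sub>q = h\<^sub>i\<^sub>j\<close> and \<open>J\<close> induces the orientation.\<close>

definition determines_complex_structure :: "'a topology \<Rightarrow> 'a chart set \<Rightarrow> 'a chart set \<Rightarrow>
    ('a, real^2^2) field set \<Rightarrow> ('a, real^2^2) field \<Rightarrow> bool" where
  "determines_complex_structure X A Or C J \<longleftrightarrow>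
     complex_structure X A J \<and> induces_orientation Or J \<and>
     (\<forall>h\<in>C. \<forall>\<kappa>\<in>A. \<forall>p\<in>fst \<kappa>. J \<kappa> p ** h \<kappa> p ** transpose (J \<kappa> p) = h \<kappa> p)"

text \<open>The graph of \<open>\<Psi>\<close>: the Einstein AH structure \<open>(P, C)\<close>, whose aligned representative
  is \<open>N\<close> and whose distinguished metric with scalar curvature \<open>-2\<close> is \<open>h\<close>, is mapped to
  \<open>(J, B)\<close> with \<open>B\<^sub>i\<^sub>j\<^sub>k = \<L>\<^sub>i\<^sub>j\<^sup>p h\<^sub>p\<^sub>k\<close>.  The fields \<open>N\<close> and \<open>h\<close> are uniquely
  determined by \<open>(P, C)\<close>.\<close>

definition Psi_graph :: "'a topology \<Rightarrow> 'a chart set \<Rightarrow> 'a chart set \<Rightarrow>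
    ('a, real^2^2^2) field set \<Rightarrow> ('a, real^2^2) field set \<Rightarrow>
    ('a, real^2^2^2) field \<Rightarrow> ('a, real^2^2) field \<Rightarrow>
    ('a, real^2^2) field \<Rightarrow> ('a, real^2^2^2) field \<Rightarrow> bool" where
  "Psi_graph X A Or P C N h J B \<longleftrightarrow>
     einstein_AH X A P C N \<and> normalized_gauduchon_metric A C N h \<and>
     determines_complex_structure X A Or C J \<and>
     (\<forall>\<kappa>\<in>A. \<forall>p\<in>fst \<kappa>. \<forall>i j k.
        B \<kappa> p $ i $ j $ k = (\<Sum>m\<in>UNIV. cubic_torsion N h \<kappa> p i j m * h \<kappa> p $ m $ k))"

end

theory Submission
  imports Defs "HOL-Complex_Analysis.Cauchy_Integral_Formula"
begin

text \<open>In a coordinate \<open>z\<close> with \<open>B = Re (Q dz\<^sup>3)\<close> write \<open>\<^sup>th = e\<^sup>u |dz|\<^sup>2\<close>.  The aligned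
  connection is the Levi-Civita connection of \<open>\<^sup>th\<close> minus half the cubic torsion, and the
  normalization of its scalar curvature becomes Wang's equation
  \<open>\<Delta>u = 2 e\<^sup>u - e\<^sup>6\<^sup>t |Q|\<^sup>2 e\<^sup>-\<^sup>2\<^sup>u\<close>.  Three applications of the maximum principle
  finish the proof: to \<open>ln |Q|\<^sup>2 - 3u\<close>, which shows that the right hand side is nonnegative; to
  \<open>\<phi>\<^sub>s - \<phi>\<^sub>t\<close> for \<open>s < t\<close>, as the right hand side increases with \<open>u\<close> and decreases with \<open>t\<close>;
  and to \<open>\<phi>\<^sub>t - \<phi>\<^sub>s\<close>, as replacing \<open>(t, u)\<close> by \<open>(t + d, u + 2d)\<close> multiplies the right hand side
  by \<open>e\<^sup>2\<^sup>d\<close>.\<close>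

unbundle no fps_syntax

section \<open>Partial derivatives and the Laplacian\<close>

text \<open>Encoded as a derivative in one real variable along a coordinate line, so that the
  calculus rules for real functions apply directly.\<close>

definition has_partial :: "(real^2 \<Rightarrow> real) \<Rightarrow> 2 \<Rightarrow> real \<Rightarrow> real^2 \<Rightarrow> bool" where
  "has_partial f i d x \<longleftrightarrow> ((\<lambda>r. f (x + r *\<^sub>R axis i 1)) has_real_derivative d) (at 0)"

text \<open>The maximum principle needs only the first partials \<open>T i\<close> near the point
  and their pure derivatives \<open>D i\<close> at it. Taking \<open>L\<close> as an argument
  asserts existence and value together.\<close>

definition has_laplacian :: "(real^2 \<Rightarrow> real) \<Rightarrow> real \<Rightarrow> real^2 \<Rightarrow> bool" where
  "has_laplacian f L x \<longleftrightarrow> (\<exists>T D. (\<forall>i. (\<forall>\<^sub>F y in nhds x. has_partial f i (T i y) y) \<and>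
     has_partial (T i) i (D i) x) \<and> L = (\<Sum>i\<in>UNIV. D i))"

lemma filterlim_line: "filterlim (\<lambda>r. x + r *\<^sub>R axis i 1) (nhds x) (nhds (0::real))"
  for x :: "real^2"
proof -
  let ?l = "\<lambda>r::real. x + r *\<^sub>R axis i 1"
  have "isCont ?l 0"
    by (intro continuous_intros)
  then have "filterlim ?l (nhds (?l 0)) (nhds 0)"
    using tendsto_at_iff_tendsto_nhds[of ?l 0] by (simp only: isCont_def)
  then show ?thesis
    by simp
qed

lemma eventually_line:
  fixes x :: "real^2"
  assumes "\<forall>\<^sub>F y in nhds x. P y"
  shows "\<forall>\<^sub>F r in nhds (0::real). P (x + r *\<^sub>R axis i 1)"
  using filterlim_line assms by (rule eventually_compose_filterlim[rotated])

lemma has_partial_cong: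
  assumes "has_partial f i d x" "\<forall>\<^sub>F y in nhds x. f y = g y"
  shows "has_partial g i d x"
  using assms(1) DERIV_cong_ev[OF refl eventually_line[OF assms(2)] refl]
  unfolding has_partial_def by blast

lemma has_partial_unique:
  assumes "has_partial f i d x" "has_partial f i e x"
  shows "d = e"
  using assms unfolding has_partial_def by (rule DERIV_unique)

lemma has_partial_lincomb:
  assumes "has_partial f i d x" "has_partial g i e x"
  shows "has_partial (\<lambda>y. a * f y + b * g y) i (a * d + b * e) x"
  using assms unfolding has_partial_def by (auto intro!: derivative_eq_intros)

lemma has_partial_diff:
  assumes "has_partial f i d x" "has_partial g i e x"
  shows "has_partial (\<lambda>y. f y - g y) i (d - e) x"
  using has_partial_lincomb[OF assms, of 1 "-1"] by simp

lemma has_partial_compose: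
  assumes "has_partial f i d x" "(F has_real_derivative e) (at (f x))"
  shows "has_partial (\<lambda>y. F (f y)) i (e * d) x"
proof -
  have "(F has_real_derivative e) (at (f (x + 0 *\<^sub>R axis i 1)))"
    using assms(2) by simp
  from DERIV_chain2[OF this assms(1)[unfolded has_partial_def]]
  show ?thesis
    unfolding has_partial_def .
qed

lemma has_partial_frechet_derivative:
  assumes "f differentiable (at x)"
  shows "has_partial f i (frechet_derivative f (at x) (axis i 1)) x"
proof -
  let ?D = "frechet_derivative f (at x)"
  have D: "(f has_derivative ?D) (at x)"
    using assms frechet_derivative_works by blast
  have "((\<lambda>r. x + r *\<^sub>R axis i 1) has_derivative (\<lambda>r. r *\<^sub>R axis i 1)) (at (0::real))"
    by (auto intro!: derivative_eq_intros)
  then have "((\<lambda>r. f (x + r *\<^sub>R axis i 1)) has_derivative (\<lambda>r. ?D (r *\<^sub>R axis i 1))) (at (0::real))"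
    by (rule has_derivative_compose) (simp add: D)
  moreover have "?D (r *\<^sub>R axis i 1) = ?D (axis i 1) * r" for r
    using linear_scale[OF has_derivative_linear[OF D]] by simp
  ultimately show ?thesis
    unfolding has_partial_def has_field_derivative_def by simp
qed

lemma has_laplacian_cong:
  assumes "has_laplacian f L x" "\<forall>\<^sub>F y in nhds x. f y = g y"
  shows "has_laplacian g L x"
proof -
  from assms(1) obtain T D where TD: "\<And>i. \<forall>\<^sub>F y in nhds x. has_partial f i (T i y) y"
    "\<And>i. has_partial (T i) i (D i) x" "L = (\<Sum>i\<in>UNIV. D i)"
    unfolding has_laplacian_def by blast
  have "\<forall>\<^sub>F y in nhds x. \<forall>\<^sub>F z in nhds y. f z = g z"
    using assms(2) by (simp add: eventually_eventually)
  then have "\<forall>\<^sub>F y in nhds x. has_partial g i (T i y) y" for i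
    using TD(1)[of i]
    by eventually_elim (blast intro: has_partial_cong)
  with TD show ?thesis
    unfolding has_laplacian_def by blast
qed

lemma has_laplacian_lincomb:
  assumes "has_laplacian f L x" "has_laplacian g M x"
  shows "has_laplacian (\<lambda>y. a * f y + b * g y) (a * L + b * M) x"
proof -
  from assms(1) obtain T D where TD: "\<And>i. \<forall>\<^sub>F y in nhds x. has_partial f i (T i y) y"
    "\<And>i. has_partial (T i) i (D i) x" "L = (\<Sum>i\<in>UNIV. D i)"
    unfolding has_laplacian_def by blast
  from assms(2) obtain S E where SE: "\<And>i. \<forall>\<^sub>F y in nhds x. has_partial g i (S i y) y"
    "\<And>i. has_partial (S i) i (E i) x" "M = (\<Sum>i\<in>UNIV. E i)"
    unfolding has_laplacian_def by blast
  have "\<forall>\<^sub>F y in nhds x. has_partial (\<lambda>y. a * f y + b * g y) i (a * T i y + b * S i y) y" for i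
    using TD(1)[of i] SE(1)[of i] by eventually_elim (rule has_partial_lincomb)
  moreover have "has_partial (\<lambda>y. a * T i y + b * S i y) i (a * D i + b * E i) x" for i
    using TD(2) SE(2) by (rule has_partial_lincomb)
  ultimately show ?thesis
    unfolding has_laplacian_def TD(3) SE(3)
    by (intro exI[of _ "\<lambda>i y. a * T i y + b * S i y"] exI[of _ "\<lambda>i. a * D i + b * E i"])
      (simp add: sum.distrib sum_distrib_left)
qed

section \<open>Maximum principle\<close>

text \<open>If \<open>D\<close> were positive, \<open>T\<close> would vanish at the maximum and be
  positive just to its right, so the mean value theorem would push \<open>g\<close> above
  \<open>g 0\<close>.\<close>

lemma second_derivative_nonpos_at_max:
  fixes g :: "real \<Rightarrow> real"
  assumes g: "\<forall>\<^sub>F r in nhds 0. (g has_real_derivative T r) (at r)"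
    and T: "(T has_real_derivative D) (at 0)"
    and max: "\<forall>\<^sub>F r in nhds 0. g r \<le> g 0"
  shows "D \<le> 0"
proof (rule ccontr)
  assume "\<not> D \<le> 0"
  obtain d where d: "d > 0" "\<And>r. \<bar>r\<bar> < d \<Longrightarrow> (g has_real_derivative T r) (at r) \<and> g r \<le> g 0"
    using eventually_conj[OF g max] unfolding eventually_nhds_metric dist_real_def by auto
  have "T 0 = 0"
    using d by (intro DERIV_local_max[of g "T 0" 0 d]) auto
  with DERIV_pos_inc_right[OF T] \<open>\<not> D \<le> 0\<close>
  obtain e where e: "e > 0" "\<And>r. 0 < r \<Longrightarrow> r < e \<Longrightarrow> T r > 0"
    by auto
  define r where "r = min d e / 2"
  have r: "0 < r" "r < d" "r < e"
    using d e by (auto simp: r_def min_def)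
  obtain z where "0 < z" "z < r" "g r - g 0 = (r - 0) * T z"
    using MVT2[of 0 r g T] r d by auto
  moreover have "T z > 0"
    using e \<open>0 < z\<close> \<open>z < r\<close> r by auto
  ultimately have "g r > g 0"
    using r by (metis diff_gt_0_iff_gt diff_zero mult_pos_pos)
  with d(2)[of r] r show False
    by auto
qed

text \<open>The restriction to each coordinate line has a local maximum, so every pure second
  partial \<open>D i\<close> is nonpositive.\<close>

lemma has_laplacian_nonpos_at_max:
  assumes "has_laplacian f L x" "\<forall>\<^sub>F y in nhds x. f y \<le> f x"
  shows "L \<le> 0"
proof -
  from assms(1) obtain T D where TD: "\<And>i. \<forall>\<^sub>F y in nhds x. has_partial f i (T i y) y"
    "\<And>i. has_partial (T i) i (D i) x" "L = (\<Sum>i\<in>UNIV. D i)"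
    unfolding has_laplacian_def by blast
  have "D i \<le> 0" for i
  proof (rule second_derivative_nonpos_at_max)
    let ?l = "\<lambda>r. x + r *\<^sub>R axis i (1::real)"
    show "\<forall>\<^sub>F r in nhds 0. ((\<lambda>r. f (?l r)) has_real_derivative T i (?l r)) (at r)"
      using eventually_line[OF TD(1)[of i], of i]
    proof eventually_elim
      case (elim r)
      \<comment> \<open>\<open>has_partial\<close> differentiates at parameter 0 of the line through
        its own base point; that point is now \<open>?l r\<close>, so the parameter is shifted by
        \<open>r\<close>.\<close>
      then have "((\<lambda>s. f (?l (s + r))) has_real_derivative T i (?l r)) (at 0)"
        unfolding has_partial_def by (simp add: algebra_simps)
      then show ?case
        using DERIV_shift[of "\<lambda>r. f (?l r)" "T i (?l r)" 0 r] by simp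
    qed
    show "((\<lambda>r. T i (?l r)) has_real_derivative D i) (at 0)"
      using TD(2) unfolding has_partial_def .
    show "\<forall>\<^sub>F r in nhds 0. f (?l r) \<le> f (?l 0)"
      using eventually_line[OF assms(2), of i] by simp
  qed
  then show ?thesis
    unfolding TD(3) by (intro sum_nonpos)
qed

section \<open>Logarithmic modulus of holomorphic functions\<close>

lemma axis_2:
  fixes c :: "'b::zero"
  shows "axis 1 c $ (1::2) = c" "axis 1 c $ (2::2) = 0" "axis 2 c $ (1::2) = 0" "axis 2 c $ (2::2) = c"
  by (simp_all add: axis_def)

lemma dz_1: "dz 1 = 1" and dz_2: "dz 2 = \<i>"
  by (simp_all add: dz_def)

text \<open>This turns the partial derivatives of a holomorphic function into its complex derivative
  times \<open>dz i\<close>.\<close>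

lemma to_complex_line: "to_complex (x + r *\<^sub>R axis i 1) = to_complex x + of_real r * dz i"
proof -
  have "to_complex (x + r *\<^sub>R axis 1 1) = to_complex x + of_real r * dz 1"
    by (rule complex_eqI) (simp_all add: to_complex_def axis_2 dz_1 dz_2)
  moreover have "to_complex (x + r *\<^sub>R axis 2 1) = to_complex x + of_real r * dz 2"
    by (rule complex_eqI) (simp_all add: to_complex_def axis_2 dz_1 dz_2)
  ultimately show ?thesis
    using exhaust_2[of i] by metis
qed

lemma continuous_to_complex: "isCont to_complex x"
  unfolding to_complex_def Complex_eq by (intro continuous_intros)

lemma eventually_to_complex:
  assumes "\<forall>\<^sub>F z in nhds (to_complex x). P z"
  shows "\<forall>\<^sub>F y in nhds x. P (to_complex y)"
  using continuous_to_complex[of x] assms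
  by (auto simp: continuous_at tendsto_at_iff_tendsto_nhds intro: eventually_compose_filterlim)

lemma has_vector_derivative_to_complex_line:
  assumes "(f has_field_derivative e) (at (to_complex x))"
  shows "((\<lambda>r. f (to_complex (x + r *\<^sub>R axis i 1))) has_vector_derivative e * dz i) (at 0)"
proof -
  have "((\<lambda>w. f (to_complex x + w * dz i)) has_field_derivative e * dz i) (at (of_real 0))"
    by (rule DERIV_chain2[where f = f]) (use assms in \<open>auto intro!: derivative_eq_intros\<close>)
  from has_vector_derivative_real_field[OF this] show ?thesis
    by (simp add: to_complex_line)
qed

text \<open>The partial derivatives of \<open>ln |f|\<^sup>2\<close> are the real parts of \<open>2 (f'/f) dz\<^sub>i\<close>, and
  \<open>dz\<^sub>1\<^sup>2 + dz\<^sub>2\<^sup>2 = 0\<close>.\<close>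

lemma has_laplacian_ln_cmod_holomorphic:
  assumes f: "f holomorphic_on V" and V: "open V" "to_complex x \<in> V" and nz: "f (to_complex x) \<noteq> 0"
  shows "has_laplacian (\<lambda>y. ln ((cmod (f (to_complex y)))\<^sup>2)) 0 x"
proof -
  let ?k = "\<lambda>z. deriv f z / f z"
  have nbhd: "\<forall>\<^sub>F z in nhds (to_complex x). z \<in> V \<and> f z \<noteq> 0"
  proof (intro eventually_conj)
    show "\<forall>\<^sub>F z in nhds (to_complex x). z \<in> V"
      using V by (rule eventually_nhds_in_open)
    have "isCont f (to_complex x)"
      using f V holomorphic_on_imp_continuous_on continuous_on_eq_continuous_at by blast
    then show "\<forall>\<^sub>F z in nhds (to_complex x). f z \<noteq> 0"
      using nz by (simp add: continuous_at tendsto_at_iff_tendsto_nhds tendsto_imp_eventually_ne)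
  qed
  have first: "has_partial (\<lambda>y. ln ((cmod (f (to_complex y)))\<^sup>2)) i (2 * Re (?k (to_complex y) * dz i)) y"
    if y: "to_complex y \<in> V" "f (to_complex y) \<noteq> 0" for i y
  proof -
    let ?g = "\<lambda>r::real. f (to_complex (y + r *\<^sub>R axis i 1))" and ?z = "to_complex y"
    have "(?g has_vector_derivative deriv f ?z * dz i) (at 0)"
      using y f V by (intro has_vector_derivative_to_complex_line holomorphic_derivI)
    then have d: "((\<lambda>r. Re (?g r)) has_real_derivative Re (deriv f ?z * dz i)) (at 0)"
      "((\<lambda>r. Im (?g r)) has_real_derivative Im (deriv f ?z * dz i)) (at 0)"
      unfolding has_real_derivative_iff_has_vector_derivative
      by (auto dest: bounded_linear.has_vector_derivative[OF bounded_linear_Re]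
          bounded_linear.has_vector_derivative[OF bounded_linear_Im])
    have pos: "(Re (f ?z))\<^sup>2 + (Im (f ?z))\<^sup>2 > 0"
      using y by (simp add: complex_eq_iff sum_power2_gt_zero_iff)
    have "((\<lambda>r. (Re (?g r))\<^sup>2 + (Im (?g r))\<^sup>2) has_real_derivative
        2 * Re (?g 0) * Re (deriv f ?z * dz i) + 2 * Im (?g 0) * Im (deriv f ?z * dz i)) (at 0)"
      by (rule derivative_eq_intros d refl)+ (simp del: times_complex.sel)
    then have "((\<lambda>r. ln ((Re (?g r))\<^sup>2 + (Im (?g r))\<^sup>2)) has_real_derivative
        1 / ((Re (?g 0))\<^sup>2 + (Im (?g 0))\<^sup>2) *
        (2 * Re (?g 0) * Re (deriv f ?z * dz i) + 2 * Im (?g 0) * Im (deriv f ?z * dz i))) (at 0)"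
      using pos by (intro DERIV_chain2[where f = ln] DERIV_ln_divide) simp_all
    also have "1 / ((Re (?g 0))\<^sup>2 + (Im (?g 0))\<^sup>2) *
        (2 * Re (?g 0) * Re (deriv f ?z * dz i) + 2 * Im (?g 0) * Im (deriv f ?z * dz i)) =
        2 * Re (?k ?z * dz i)"
      by (simp add: Re_divide Im_divide add_divide_distrib diff_divide_distrib algebra_simps)
    finally show ?thesis
      unfolding has_partial_def cmod_power2 .
  qed
  obtain e where e: "(?k has_field_derivative e) (at (to_complex x))"
  proof -
    have "deriv f holomorphic_on V"
      using f V by (intro holomorphic_deriv)
    then show thesis
      using that DERIV_divide holomorphic_derivI[OF f V] holomorphic_derivI[OF _ V] nz by blast
  qed
  have second: "has_partial (\<lambda>y. 2 * Re (?k (to_complex y) * dz i)) i (2 * Re (e * dz i * dz i)) x" for i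
  proof -
    let ?g = "\<lambda>r::real. ?k (to_complex (x + r *\<^sub>R axis i 1))"
    have "((\<lambda>r. 2 * Re (?g r * dz i)) has_vector_derivative 2 * Re (e * dz i * dz i)) (at 0)"
      using has_vector_derivative_to_complex_line[OF e, of i]
      by (intro has_vector_derivative_mult_right has_vector_derivative_mult_left
          bounded_linear.has_vector_derivative[OF bounded_linear_Re])
    then show ?thesis
      by (simp add: has_partial_def has_real_derivative_iff_has_vector_derivative)
  qed
  have "\<forall>\<^sub>F y in nhds x. has_partial (\<lambda>y. ln ((cmod (f (to_complex y)))\<^sup>2)) i
      (2 * Re (?k (to_complex y) * dz i)) y" for i
    using eventually_to_complex[OF nbhd] by eventually_elim (use first in simp)
  then show ?thesis
    unfolding has_laplacian_def
    by (intro exI[of _ "\<lambda>i y. 2 * Re (?k (to_complex y) * dz i)"]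
        exI[of _ "\<lambda>i. 2 * Re (e * dz i * dz i)"] conjI allI second)
      (auto simp: UNIV_2 dz_def)
qed

section \<open>Charts\<close>

lemma param_in: "x \<in> snd \<kappa> ` fst \<kappa> \<Longrightarrow> param \<kappa> x \<in> fst \<kappa>"
  unfolding param_def by (rule inv_into_into)

lemma coordinate_param: "x \<in> snd \<kappa> ` fst \<kappa> \<Longrightarrow> snd \<kappa> (param \<kappa> x) = x"
  unfolding param_def by (rule f_inv_into_f)

lemma is_chart_open: "is_chart X \<kappa> \<Longrightarrow> open (snd \<kappa> ` fst \<kappa>)"
  by (simp add: is_chart_def)

lemma smooth_surface_chart: "smooth_surface X A \<Longrightarrow> \<kappa> \<in> A \<Longrightarrow> is_chart X \<kappa>"
  unfolding smooth_surface_def by blast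

lemma smooth_surface_open_image: "smooth_surface X A \<Longrightarrow> \<kappa> \<in> A \<Longrightarrow> open (snd \<kappa> ` fst \<kappa>)"
  by (rule is_chart_open[OF smooth_surface_chart])

lemma param_coordinate:
  assumes "is_chart X \<kappa>" "p \<in> fst \<kappa>"
  shows "param \<kappa> (snd \<kappa> p) = p"
proof -
  have "fst \<kappa> \<subseteq> topspace X"
    using assms by (auto simp: is_chart_def dest: openin_subset)
  then have "topspace (subtopology X (fst \<kappa>)) = fst \<kappa>"
    by (rule topspace_subtopology_subset)
  then have "inj_on (snd \<kappa>) (fst \<kappa>)"
    using assms homeomorphic_imp_injective_map unfolding is_chart_def by metis
  then show ?thesis
    using assms by (simp add: param_def)
qed

lemma smooth_on_differentiable: "smooth_on f S \<Longrightarrow> x \<in> S \<Longrightarrow> f differentiable (at x)"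
  unfolding smooth_on_def using ck_on.simps(2)[of 0 f S] by blast

lemma smooth_on_continuous: "smooth_on f S \<Longrightarrow> continuous_on S f"
  unfolding smooth_on_def using ck_on.simps(1)[of f S] by blast

lemma differentiable_vec_nth:
  assumes "f differentiable (at x)"
  shows "(\<lambda>y. f y $ i) differentiable (at x)"
proof -
  obtain f' where "(f has_derivative f') (at x)"
    using assms differentiable_def by blast
  then have "((\<lambda>y. f y $ i) has_derivative (\<lambda>v. f' v $ i)) (at x)"
    by (rule bounded_linear.has_derivative[OF bounded_linear_vec_nth])
  then show ?thesis
    by (rule differentiableI)
qed

lemma has_partial_pd:
  assumes "(\<lambda>y. f (param \<kappa> y)) differentiable (at x)" "x \<in> snd \<kappa> ` fst \<kappa>"
  shows "has_partial (\<lambda>y. f (param \<kappa> y)) i (pd \<kappa> i f (param \<kappa> x)) x"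
  using has_partial_frechet_derivative[OF assms(1)] coordinate_param[OF assms(2)]
  by (simp add: pd_def)

text \<open>Components carry no meaning off the chart domain, so the comparison of derivatives is
  localized to the open coordinate image.\<close>

lemma pd_cong:
  assumes "open (snd \<kappa> ` fst \<kappa>)" "p \<in> fst \<kappa>" "(\<lambda>y. f (param \<kappa> y)) differentiable (at (snd \<kappa> p))"
    and "\<And>q. q \<in> fst \<kappa> \<Longrightarrow> f q = g q"
  shows "pd \<kappa> i f p = pd \<kappa> i g p"
proof -
  have "f (param \<kappa> y) = g (param \<kappa> y)" if "y \<in> snd \<kappa> ` fst \<kappa>" for y
    using assms(4) param_in[OF that] by blast
  then have "frechet_derivative (\<lambda>y. f (param \<kappa> y)) (at (snd \<kappa> p)) =
      frechet_derivative (\<lambda>y. g (param \<kappa> y)) (at (snd \<kappa> p))"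
    by (intro frechet_derivative_transform_within_open[OF assms(3,1)] imageI assms(2))
  then show ?thesis
    by (simp add: pd_def)
qed

section \<open>Conformal coordinates\<close>

text \<open>Here \<open>J\<close> is the standard quarter turn. Its compatibility with
  \<open>h\<close> equates the diagonal entries and makes the off-diagonal ones opposite, while
  symmetry makes them equal, hence zero.\<close>

lemma conformal_coordinates:
  assumes "determines_complex_structure X A Or C J" "riemannian_metric A h" "h \<in> C"
    and "\<kappa> \<in> A" "holo_chart J \<kappa>" "p \<in> fst \<kappa>"
  shows "h \<kappa> p = (h \<kappa> p $ 1 $ 1) *\<^sub>R mat 1" and "h \<kappa> p $ 1 $ 1 > 0"
proof -
  let ?h = "h \<kappa> p" and ?J = "J \<kappa> p"
  have J: "?J $ 1 $ 1 = 0" "?J $ 1 $ 2 = 1" "?J $ 2 $ 1 = -1" "?J $ 2 $ 2 = 0"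
    using assms(5,6) by (auto simp: holo_chart_def)
  have "(?J ** ?h ** transpose ?J) $ i $ j = ?h $ i $ j" for i j
    using assms by (simp add: determines_complex_structure_def)
  from this[of 1 1] this[of 1 2] have eqs: "?h $ 2 $ 2 = ?h $ 1 $ 1" "- ?h $ 2 $ 1 = ?h $ 1 $ 2"
    by (simp_all add: matrix_matrix_mult_def transpose_def sum_2 J)
  have "transpose ?h $ 1 $ 2 = ?h $ 1 $ 2"
    using assms by (simp add: riemannian_metric_def)
  then have "?h $ 2 $ 1 = ?h $ 1 $ 2"
    by (simp add: transpose_def)
  with eqs show "?h = (?h $ 1 $ 1) *\<^sub>R mat 1"
    by (simp add: vec_eq_iff forall_2 mat_def)
  have "axis 1 1 \<bullet> (?h *v axis 1 1) > 0"
    using assms by (simp add: riemannian_metric_def axis_eq_0_iff)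
  then show "?h $ 1 $ 1 > 0"
    by (simp add: inner_vec_def matrix_vector_mult_def sum_2 axis_2)
qed

text \<open>The determinant is \<open>c\<close> squared, so the weight cancels \<open>c\<close>. In
  a holomorphic coordinate \<open>H\<close> is therefore the constant identity and its coordinate
  derivatives vanish.\<close>

lemma Hl_conformal:
  assumes "h \<kappa> p = c *\<^sub>R mat 1" "c > 0"
  shows "Hl h \<kappa> p = mat 1"
proof -
  have "det (h \<kappa> p) = c\<^sup>2"
    by (simp add: assms(1) det_2 mat_def power2_eq_square)
  moreover have "(c\<^sup>2) powr (-1/2) = 1 / c"
    using assms(2) powr_minus[of "c\<^sup>2" "1/2"] by (simp add: powr_half_sqrt field_simps)
  ultimately show ?thesis
    using assms by (simp add: Hl_def)
qed

text \<open>\<open>matrix_inv\<close> is defined by choice, so the inverse has to be shown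
  unique.\<close>

lemma matrix_inv_scaleR_mat:
  assumes "c \<noteq> (0::real)"
  shows "matrix_inv (c *\<^sub>R mat 1 :: real^'n^'n) = (1 / c) *\<^sub>R mat 1"
proof -
  let ?M = "c *\<^sub>R mat 1 :: real^'n^'n" and ?N = "(1 / c) *\<^sub>R mat 1 :: real^'n^'n"
  have N: "?M ** ?N = mat 1" "?N ** ?M = mat 1"
    using assms by (simp_all add: matrix_scalar_ac flip: scalar_matrix_assoc)
  have "A = ?N" if "?M ** A = mat 1" for A
    by (metis N(2) matrix_mul_assoc matrix_mul_lid matrix_mul_rid that)
  with N show ?thesis
    unfolding matrix_inv_def by (intro some_equality conjI) blast+
qed

lemma matrix_inv_mat_1: "matrix_inv (mat 1 :: real^'n^'n) = mat 1"
  using matrix_inv_scaleR_mat[of 1] by simp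

section \<open>Wang's equation from the curvature normalization\<close>

text \<open>The distinguished condition makes the partials of \<open>ln c\<close> the traces of the
  connection. Their divergence is read off from \<open>R_11 + R_22 = -2 c\<close>, and the quadratic
  curvature terms become the norm of \<open>B\<close>. Since \<open>B\<close> is \<open>c\<close>
  times \<open>nabla_H\<close>, which is symmetric in its last two indices, \<open>sym\<close> is
  the alignment condition in components.\<close>

lemma laplacian_ln_conformal_factor:
  assumes surface: "smooth_surface X A" and Psi: "Psi_graph X A Or P C N h J B"
    and \<kappa>: "\<kappa> \<in> A" "holo_chart J \<kappa>"
    and sym: "\<And>p. p \<in> fst \<kappa> \<Longrightarrow> B \<kappa> p $ 2 $ 1 $ 1 = B \<kappa> p $ 1 $ 1 $ 2 \<and> B \<kappa> p $ 2 $ 1 $ 2 = B \<kappa> p $ 1 $ 2 $ 2"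
    and x: "x \<in> snd \<kappa> ` fst \<kappa>"
  defines "c \<equiv> \<lambda>p. h \<kappa> p $ 1 $ 1"
  shows "has_laplacian (\<lambda>y. ln (c (param \<kappa> y)))
    (2 * c (param \<kappa> x) - ((B \<kappa> (param \<kappa> x) $ 1 $ 1 $ 1)\<^sup>2 + (B \<kappa> (param \<kappa> x) $ 1 $ 1 $ 2)\<^sup>2) / (c (param \<kappa> x))\<^sup>2) x"
proof -
  let ?U = "snd \<kappa> ` fst \<kappa>"
  have U: "open ?U"
    using surface \<kappa>(1) by (rule smooth_surface_open_image)
  have hC: "h \<in> C" "riemannian_metric A h"
    using Psi by (auto simp: Psi_graph_def normalized_gauduchon_metric_def distinguished_metric_def
        einstein_AH_def AH_structure_def conformal_structure_def)
  have N: "torsion_free_connection A N"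
    using Psi by (auto simp: Psi_graph_def einstein_AH_def AH_structure_def aligned_representative_def
        projective_structure_def)
  have h: "h \<kappa> p = c p *\<^sub>R mat 1" and c: "c p > 0" if "p \<in> fst \<kappa>" for p
    using conformal_coordinates[OF _ hC(2,1) \<kappa> that] Psi by (auto simp: Psi_graph_def c_def)
  have Hl: "Hl h \<kappa> p = mat 1" if "p \<in> fst \<kappa>" for p
    by (rule Hl_conformal[where c = "c p"]) (use h c that in auto)
  have Hu: "Hu h \<kappa> p = mat 1" if "p \<in> fst \<kappa>" for p
    using that by (simp add: Hu_def Hl matrix_inv_mat_1)
  have c_diff: "(\<lambda>y. c (param \<kappa> y)) differentiable (at y)" if "y \<in> ?U" for y
    unfolding c_def using hC(2) \<kappa> that
    by (intro differentiable_vec_nth smooth_on_differentiable) (auto simp: riemannian_metric_def smooth_field_def)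
  have N_diff: "(\<lambda>y. N \<kappa> (param \<kappa> y) $ i $ j $ k) differentiable (at y)" if "y \<in> ?U" for y i j k
    using N \<kappa> that
    by (intro differentiable_vec_nth smooth_on_differentiable)
      (auto simp: torsion_free_connection_def smooth_field_def)
  have pd_Hl: "pd \<kappa> i (\<lambda>q. Hl h \<kappa> q $ j $ k) p = 0" if "p \<in> fst \<kappa>" for i j k p
  proof -
    have "pd \<kappa> i (\<lambda>q. mat 1 $ j $ k) p = pd \<kappa> i (\<lambda>q. Hl h \<kappa> q $ j $ k) p"
      using U that by (rule pd_cong) (auto simp: Hl)
    then show ?thesis
      by (simp add: pd_def frechet_derivative_const)
  qed
  have N_sym: "N \<kappa> p $ i $ j $ k = N \<kappa> p $ j $ i $ k" if "p \<in> fst \<kappa>" for p i j k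
    using N \<kappa> that by (auto simp: torsion_free_connection_def)
  have "nabla_H N h \<kappa> p i j k = - N \<kappa> p $ i $ j $ k - N \<kappa> p $ i $ k $ j + (if j = k then trace_conn N \<kappa> p i else 0)"
    if "p \<in> fst \<kappa>" for p i j k
    using that exhaust_2[of j] exhaust_2[of k]
    by (auto simp: nabla_H_def pd_Hl Hl mat_def sum_2)
  moreover have "B \<kappa> p $ i $ j $ k = c p * nabla_H N h \<kappa> p i j k" if "p \<in> fst \<kappa>" for p i j k
  proof -
    have "B \<kappa> p $ i $ j $ k = (\<Sum>m\<in>UNIV. cubic_torsion N h \<kappa> p i j m * h \<kappa> p $ m $ k)"
      using Psi \<kappa> that by (simp add: Psi_graph_def)
    then show ?thesis
      using that exhaust_2[of k] by (auto simp: cubic_torsion_def Hu h mat_def sum_2)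
  qed
  ultimately have B_eq: "B \<kappa> p $ i $ j $ k = c p * (- N \<kappa> p $ i $ j $ k - N \<kappa> p $ i $ k $ j +
      (if j = k then trace_conn N \<kappa> p i else 0))" if "p \<in> fst \<kappa>" for p i j k
    using that by simp
  \<comment> \<open>With torsion-freeness, \<open>sym\<close> says that the Euclidean contraction of
    the two lower indices of the Christoffel symbols vanishes.\<close>
  have rel: "N \<kappa> p $ 2 $ 2 $ 1 = - N \<kappa> p $ 1 $ 1 $ 1" "N \<kappa> p $ 2 $ 2 $ 2 = - N \<kappa> p $ 1 $ 1 $ 2"
    if p: "p \<in> fst \<kappa>" for p
  proof -
    show "N \<kappa> p $ 2 $ 2 $ 1 = - N \<kappa> p $ 1 $ 1 $ 1"
      using sym[OF p] c[OF p] N_sym[OF p, of 2 1]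
      by (simp add: B_eq[OF p] trace_conn_def sum_2)
    show "N \<kappa> p $ 2 $ 2 $ 2 = - N \<kappa> p $ 1 $ 1 $ 2"
      using sym[OF p] c[OF p] N_sym[OF p, of 2 1]
      by (simp add: B_eq[OF p] trace_conn_def sum_2)
  qed
  \<comment> \<open>The traces \<open>\<Gamma>\<^sub>i\<^sub>p\<^sup>p\<close> written so that their divergence is minus the second order part of
    \<open>R\<^sub>1\<^sub>1 + R\<^sub>2\<^sub>2\<close>; no derivatives of \<open>B\<close> remain.\<close>
  define T where "T = (\<lambda>(i::2) y. if i = 1 then N \<kappa> (param \<kappa> y) $ 2 $ 1 $ 2 - N \<kappa> (param \<kappa> y) $ 2 $ 2 $ 1
    else N \<kappa> (param \<kappa> y) $ 1 $ 2 $ 1 - N \<kappa> (param \<kappa> y) $ 1 $ 1 $ 2)"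
  have T_trace: "T i y = trace_conn N \<kappa> (param \<kappa> y) i" if "y \<in> ?U" for i y
    using exhaust_2[of i] rel[OF param_in[OF that]] N_sym[OF param_in[OF that], of 2 1]
    by (auto simp: T_def trace_conn_def sum_2)
  have first: "has_partial (\<lambda>y. ln (c (param \<kappa> y))) i (T i y) y" if y: "y \<in> ?U" for i y
  proof -
    let ?p = "param \<kappa> y"
    have p: "?p \<in> fst \<kappa>"
      using y by (rule param_in)
    have 1: "has_partial (\<lambda>y. c (param \<kappa> y)) i (pd \<kappa> i c ?p) y"
      using c_diff[OF y] y by (rule has_partial_pd)
    \<comment> \<open>The distinguished condition constrains \<open>|det h|\<close>, which is
      \<open>c\<close> squared here; computing its partial in two ways yields the partial of
      \<open>c\<close>.\<close>
    have "has_partial (\<lambda>y. (c (param \<kappa> y))\<^sup>2) i (2 * c ?p * pd \<kappa> i c ?p) y"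
      by (rule has_partial_compose[OF 1]) (auto intro!: derivative_eq_intros)
    moreover have "has_partial (\<lambda>y. (c (param \<kappa> y))\<^sup>2) i (pd \<kappa> i (\<lambda>q. (c q)\<^sup>2) ?p) y"
      using c_diff[OF y] y by (intro has_partial_pd) (auto intro: differentiable_power)
    moreover have "pd \<kappa> i (\<lambda>q. (c q)\<^sup>2) ?p = pd \<kappa> i (\<lambda>q. \<bar>det (h \<kappa> q)\<bar>) ?p"
      using U p
    proof (rule pd_cong)
      show "(\<lambda>y. (c (param \<kappa> y))\<^sup>2) differentiable at (snd \<kappa> ?p)"
        using c_diff y by (auto simp: coordinate_param intro: differentiable_power)
    qed (simp add: h det_2 mat_def power2_eq_square)
    moreover have "pd \<kappa> i (\<lambda>q. \<bar>det (h \<kappa> q)\<bar>) ?p = 2 * trace_conn N \<kappa> ?p i * (c ?p)\<^sup>2"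
      using Psi \<kappa> p by (simp add: Psi_graph_def normalized_gauduchon_metric_def distinguished_metric_def
          h det_2 mat_def power2_eq_square)
    ultimately have "2 * c ?p * pd \<kappa> i c ?p = 2 * trace_conn N \<kappa> ?p i * (c ?p)\<^sup>2"
      using has_partial_unique by metis
    then have eq: "inverse (c ?p) * pd \<kappa> i c ?p = T i y"
      using c[OF p] by (simp add: T_trace[OF y] field_simps power2_eq_square)
    have "has_partial (\<lambda>y. ln (c (param \<kappa> y))) i (inverse (c ?p) * pd \<kappa> i c ?p) y"
      using c[OF p] by (intro has_partial_compose[OF 1] DERIV_ln)
    then show ?thesis
      by (simp only: eq)
  qed
  let ?p = "param \<kappa> x"
  have p: "?p \<in> fst \<kappa>"
    using x by (rule param_in)
  define D where "D = (\<lambda>i::2. if i = 1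
    then pd \<kappa> 1 (\<lambda>q. N \<kappa> q $ 2 $ 1 $ 2) ?p - pd \<kappa> 1 (\<lambda>q. N \<kappa> q $ 2 $ 2 $ 1) ?p
    else pd \<kappa> 2 (\<lambda>q. N \<kappa> q $ 1 $ 2 $ 1) ?p - pd \<kappa> 2 (\<lambda>q. N \<kappa> q $ 1 $ 1 $ 2) ?p)"
  have second: "has_partial (T i) i (D i) x" for i
    using exhaust_2[of i] unfolding T_def D_def
    by (auto intro!: has_partial_diff has_partial_pd N_diff x)
  have scal: "ricci N \<kappa> ?p 1 1 + ricci N \<kappa> ?p 2 2 = - 2 * c ?p"
  proof -
    have "scalar_curvature N h \<kappa> ?p = -2"
      using Psi \<kappa> p by (simp add: Psi_graph_def normalized_gauduchon_metric_def)
    moreover have "matrix_inv (h \<kappa> ?p) = (1 / c ?p) *\<^sub>R mat 1"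
      unfolding h[OF p] using c[OF p] by (intro matrix_inv_scaleR_mat) simp
    ultimately show ?thesis
      using c[OF p] by (simp add: scalar_curvature_def sum_2 mat_def field_simps)
  qed
  \<comment> \<open>The relations \<open>rel\<close> collapse the quadratic terms to two squares,
    those of \<open>B_111 / c\<close> and \<open>B_112 / c\<close>.\<close>
  have "ricci N \<kappa> ?p 1 1 + ricci N \<kappa> ?p 2 2 = - (D 1 + D 2) -
      (N \<kappa> ?p $ 1 $ 2 $ 2 - N \<kappa> ?p $ 1 $ 1 $ 1)\<^sup>2 - (N \<kappa> ?p $ 1 $ 1 $ 2 + N \<kappa> ?p $ 1 $ 2 $ 1)\<^sup>2"
    using rel[OF p] N_sym[OF p, of 2 1]
    by (simp add: ricci_def curvature_def sum_2 D_def power2_eq_square algebra_simps)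
  moreover have "(N \<kappa> ?p $ 1 $ 2 $ 2 - N \<kappa> ?p $ 1 $ 1 $ 1)\<^sup>2 = (B \<kappa> ?p $ 1 $ 1 $ 1)\<^sup>2 / (c ?p)\<^sup>2"
    "(N \<kappa> ?p $ 1 $ 1 $ 2 + N \<kappa> ?p $ 1 $ 2 $ 1)\<^sup>2 = (B \<kappa> ?p $ 1 $ 1 $ 2)\<^sup>2 / (c ?p)\<^sup>2"
  proof -
    have "B \<kappa> ?p $ 1 $ 1 $ 1 = c ?p * (N \<kappa> ?p $ 1 $ 2 $ 2 - N \<kappa> ?p $ 1 $ 1 $ 1)"
      "B \<kappa> ?p $ 1 $ 1 $ 2 = c ?p * - (N \<kappa> ?p $ 1 $ 1 $ 2 + N \<kappa> ?p $ 1 $ 2 $ 1)"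
      by (simp_all add: B_eq[OF p] trace_conn_def sum_2)
    then show "(N \<kappa> ?p $ 1 $ 2 $ 2 - N \<kappa> ?p $ 1 $ 1 $ 1)\<^sup>2 = (B \<kappa> ?p $ 1 $ 1 $ 1)\<^sup>2 / (c ?p)\<^sup>2"
      "(N \<kappa> ?p $ 1 $ 1 $ 2 + N \<kappa> ?p $ 1 $ 2 $ 1)\<^sup>2 = (B \<kappa> ?p $ 1 $ 1 $ 2)\<^sup>2 / (c ?p)\<^sup>2"
      using c[OF p] by (simp_all only: power_mult_distrib power2_minus) simp_all
  qed
  ultimately have "2 * c ?p - ((B \<kappa> ?p $ 1 $ 1 $ 1)\<^sup>2 + (B \<kappa> ?p $ 1 $ 1 $ 2)\<^sup>2) / (c ?p)\<^sup>2 = (\<Sum>i\<in>UNIV. D i)"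
    using scal by (simp add: sum_2 add_divide_distrib)
  moreover have "\<forall>\<^sub>F y in nhds x. has_partial (\<lambda>y. ln (c (param \<kappa> y))) i (T i y) y" for i
    using eventually_nhds_in_open[OF U x] by eventually_elim (rule first)
  ultimately show ?thesis
    unfolding has_laplacian_def using second by blast
qed

section \<open>Cubic differentials\<close>

text \<open>The metric is diagonal in the second coordinate, so only the squared length of the first
  row of \<open>jac\<close> survives; it is \<open>|dw/dz|^2\<close> for the transition from
  \<open>z\<close> to \<open>w\<close>.\<close>

lemma conformal_factor_transform:
  assumes "riemannian_metric A h" "h \<in> C" "determines_complex_structure X A Or C J"
    and "\<kappa> \<in> A" "\<kappa>' \<in> A" "holo_chart J \<kappa>" "holo_chart J \<kappa>'" "p \<in> fst \<kappa>" "p \<in> fst \<kappa>'"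
  shows "h \<kappa> p $ 1 $ 1 = ((jac \<kappa> \<kappa>' p $ 1 $ 1)\<^sup>2 + (jac \<kappa> \<kappa>' p $ 1 $ 2)\<^sup>2) * h \<kappa>' p $ 1 $ 1"
proof -
  have "h \<kappa> p $ 1 $ 1 = (\<Sum>a\<in>UNIV. \<Sum>b\<in>UNIV. jac \<kappa> \<kappa>' p $ 1 $ a * jac \<kappa> \<kappa>' p $ 1 $ b * h \<kappa>' p $ a $ b)"
    using assms(1,4,5,8,9) unfolding riemannian_metric_def by blast
  moreover have "h \<kappa>' p $ 1 $ 2 = 0" "h \<kappa>' p $ 2 $ 1 = 0" "h \<kappa>' p $ 2 $ 2 = h \<kappa>' p $ 1 $ 1"
    by (subst conformal_coordinates(1)[OF assms(3,1,2,5,7,9)], simp add: mat_def)+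
  ultimately show ?thesis
    by (simp add: sum_2 algebra_simps power2_eq_square)
qed

text \<open>These are the Cauchy-Riemann equations: the Jacobian commutes with the standard quarter
  turn.\<close>

lemma holo_chart_jac:
  assumes "complex_structure X A J" "\<kappa> \<in> A" "\<kappa>' \<in> A" "holo_chart J \<kappa>" "holo_chart J \<kappa>'"
    "p \<in> fst \<kappa>" "p \<in> fst \<kappa>'"
  shows "jac \<kappa> \<kappa>' p $ 2 $ 1 = - jac \<kappa> \<kappa>' p $ 1 $ 2" "jac \<kappa> \<kappa>' p $ 2 $ 2 = jac \<kappa> \<kappa>' p $ 1 $ 1"
proof -
  have "(J \<kappa> p ** jac \<kappa> \<kappa>' p) $ 1 $ j = (jac \<kappa> \<kappa>' p ** J \<kappa>' p) $ 1 $ j" for j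
    using assms by (simp add: complex_structure_def)
  from this[of 1] this[of 2] show "jac \<kappa> \<kappa>' p $ 2 $ 1 = - jac \<kappa> \<kappa>' p $ 1 $ 2"
    "jac \<kappa> \<kappa>' p $ 2 $ 2 = jac \<kappa> \<kappa>' p $ 1 $ 1"
    using assms(4-7) by (simp_all add: holo_chart_def matrix_matrix_mult_def sum_2)
qed

text \<open>Since \<open>dz 2\<close> is the imaginary unit, each component is the real part of
  \<open>q\<close> times a power of it, so only \<open>Re q\<close> and \<open>Im q\<close> occur,
  up to sign.\<close>

lemma cubic_differential_components:
  assumes "real_part_of_cubic_differential A J B" "\<kappa> \<in> A" "holo_chart J \<kappa>" "p \<in> fst \<kappa>"
  shows "B \<kappa> p $ 1 $ 2 $ 1 = B \<kappa> p $ 1 $ 1 $ 2" "B \<kappa> p $ 2 $ 1 $ 1 = B \<kappa> p $ 1 $ 1 $ 2"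
    "B \<kappa> p $ 1 $ 2 $ 2 = - B \<kappa> p $ 1 $ 1 $ 1" "B \<kappa> p $ 2 $ 1 $ 2 = - B \<kappa> p $ 1 $ 1 $ 1"
    "B \<kappa> p $ 2 $ 2 $ 1 = - B \<kappa> p $ 1 $ 1 $ 1" "B \<kappa> p $ 2 $ 2 $ 2 = - B \<kappa> p $ 1 $ 1 $ 2"
proof -
  obtain q where "\<And>i j k. B \<kappa> p $ i $ j $ k = Re (q * dz i * dz j * dz k)"
    using assms unfolding real_part_of_cubic_differential_def by blast
  then show "B \<kappa> p $ 1 $ 2 $ 1 = B \<kappa> p $ 1 $ 1 $ 2" "B \<kappa> p $ 2 $ 1 $ 1 = B \<kappa> p $ 1 $ 1 $ 2"
    "B \<kappa> p $ 1 $ 2 $ 2 = - B \<kappa> p $ 1 $ 1 $ 1" "B \<kappa> p $ 2 $ 1 $ 2 = - B \<kappa> p $ 1 $ 1 $ 1"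
    "B \<kappa> p $ 2 $ 2 $ 1 = - B \<kappa> p $ 1 $ 1 $ 1" "B \<kappa> p $ 2 $ 2 $ 2 = - B \<kappa> p $ 1 $ 1 $ 2"
    by (simp_all add: dz_1 dz_2)
qed

text \<open>In a holomorphic coordinate this is \<open>|Q|^2\<close>: the two components are the
  real part and minus the imaginary part of \<open>Q\<close>. Using \<open>B\<close> avoids a choice
  of \<open>Q\<close>.\<close>

definition cubic_sq :: "('a, real^2^2^2) field \<Rightarrow> 'a chart \<Rightarrow> 'a \<Rightarrow> real" where
  "cubic_sq B \<kappa> p = (B \<kappa> p $ 1 $ 1 $ 1)\<^sup>2 + (B \<kappa> p $ 1 $ 1 $ 2)\<^sup>2"

text \<open>\<open>Q\<close> picks up the cube of \<open>dw/dz\<close>, hence \<open>|Q|^2\<close>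
  the cube of \<open>|dw/dz|^2\<close>.\<close>

lemma cubic_sq_transform:
  assumes "complex_structure X A J" "real_part_of_cubic_differential A J B"
    and "\<kappa> \<in> A" "\<kappa>' \<in> A" "holo_chart J \<kappa>" "holo_chart J \<kappa>'" "p \<in> fst \<kappa>" "p \<in> fst \<kappa>'"
  shows "cubic_sq B \<kappa> p = ((jac \<kappa> \<kappa>' p $ 1 $ 1)\<^sup>2 + (jac \<kappa> \<kappa>' p $ 1 $ 2)\<^sup>2) ^ 3 * cubic_sq B \<kappa>' p"
proof -
  let ?x = "jac \<kappa> \<kappa>' p $ 1 $ 1" and ?y = "jac \<kappa> \<kappa>' p $ 1 $ 2"
  let ?a = "B \<kappa>' p $ 1 $ 1 $ 1" and ?b = "B \<kappa>' p $ 1 $ 1 $ 2"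
  have tr: "B \<kappa> p $ i $ j $ k = (\<Sum>a\<in>UNIV. \<Sum>b\<in>UNIV. \<Sum>c\<in>UNIV. jac \<kappa> \<kappa>' p $ i $ a * jac \<kappa> \<kappa>' p $ j $ b *
           jac \<kappa> \<kappa>' p $ k $ c * B \<kappa>' p $ a $ b $ c)" for i j k
    using assms(2-4,7,8) unfolding real_part_of_cubic_differential_def cubic_tensor_def by blast
  note comps = cubic_differential_components[OF assms(2,4,6,8)] holo_chart_jac[OF assms(1,3-8)]
  \<comment> \<open>This component and the next are the real part and minus the imaginary part of
    \<open>(x + i y)^3 (a - i b)\<close>, where \<open>x + i y\<close> is the derivative of the
    transition.\<close>
  have "B \<kappa> p $ 1 $ 1 $ 1 = ?x ^ 3 * ?a + 3 * ?x\<^sup>2 * ?y * ?b - 3 * ?x * ?y\<^sup>2 * ?a - ?y ^ 3 * ?b"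
    unfolding tr sum_2 comps by (simp add: algebra_simps power2_eq_square power3_eq_cube)
  moreover have "B \<kappa> p $ 1 $ 1 $ 2 = ?x ^ 3 * ?b - 3 * ?x\<^sup>2 * ?y * ?a - 3 * ?x * ?y\<^sup>2 * ?b + ?y ^ 3 * ?a"
    unfolding tr sum_2 comps by (simp add: algebra_simps power2_eq_square power3_eq_cube)
  \<comment> \<open>Multiplicativity of the squared modulus, in real terms.\<close>
  moreover have "(x ^ 3 * a + 3 * x\<^sup>2 * y * b - 3 * x * y\<^sup>2 * a - y ^ 3 * b)\<^sup>2 +
      (x ^ 3 * b - 3 * x\<^sup>2 * y * a - 3 * x * y\<^sup>2 * b + y ^ 3 * a)\<^sup>2 =
      (x\<^sup>2 + y\<^sup>2) ^ 3 * (a\<^sup>2 + b\<^sup>2)" for x y a b :: real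
    by (simp add: power2_eq_square power3_eq_cube algebra_simps)
  ultimately show ?thesis
    unfolding cubic_sq_def by (simp only:)
qed

text \<open>Numerator and denominator both acquire the factor \<open>?r ^ 3\<close>, which is
  nonzero because \<open>h\<close> is positive. The quotient thus defines a function on the
  surface.\<close>

lemma cubic_sq_norm_invariant:
  assumes "determines_complex_structure X A Or C J" "riemannian_metric A h" "h \<in> C"
    and "real_part_of_cubic_differential A J B"
    and "\<kappa> \<in> A" "\<kappa>' \<in> A" "holo_chart J \<kappa>" "holo_chart J \<kappa>'" "p \<in> fst \<kappa>" "p \<in> fst \<kappa>'"
  shows "cubic_sq B \<kappa> p / (h \<kappa> p $ 1 $ 1) ^ 3 = cubic_sq B \<kappa>' p / (h \<kappa>' p $ 1 $ 1) ^ 3"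
proof -
  let ?r = "(jac \<kappa> \<kappa>' p $ 1 $ 1)\<^sup>2 + (jac \<kappa> \<kappa>' p $ 1 $ 2)\<^sup>2"
  have cs: "complex_structure X A J"
    using assms(1) by (simp add: determines_complex_structure_def)
  have h: "h \<kappa> p $ 1 $ 1 = ?r * h \<kappa>' p $ 1 $ 1"
    by (rule conformal_factor_transform[OF assms(2,3,1,5-10)])
  have "h \<kappa> p $ 1 $ 1 > 0"
    by (rule conformal_coordinates(2)[OF assms(1-3,5,7,9)])
  with h have "?r \<noteq> 0"
    by auto
  then show ?thesis
    unfolding h cubic_sq_transform[OF cs assms(4-10)] power_mult_distrib
    by (intro mult_divide_mult_cancel_left power_not_zero)
qed

text \<open>In the chart \<open>cubic_sq\<close> is \<open>|Q|^2\<close> with \<open>Q\<close>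
  holomorphic, so the computation for \<open>ln |f|^2\<close> applies away from its zeros.\<close>

lemma ln_cubic_sq_harmonic:
  assumes surface: "smooth_surface X A" and B: "real_part_of_cubic_differential A J B"
    and \<kappa>: "\<kappa> \<in> A" "holo_chart J \<kappa>" and x: "x \<in> snd \<kappa> ` fst \<kappa>"
    and nz: "cubic_sq B \<kappa> (param \<kappa> x) \<noteq> 0"
  shows "has_laplacian (\<lambda>y. ln (cubic_sq B \<kappa> (param \<kappa> y))) 0 x"
proof -
  let ?U = "snd \<kappa> ` fst \<kappa>" and ?V = "to_complex ` snd \<kappa> ` fst \<kappa>"
  have U: "open ?U"
    using surface \<kappa>(1) by (rule smooth_surface_open_image)
  obtain Q where Q: "(\<lambda>z. Q \<kappa> (param \<kappa> (of_complex z))) holomorphic_on ?V"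
    "\<And>p i j k. p \<in> fst \<kappa> \<Longrightarrow> B \<kappa> p $ i $ j $ k = Re (Q \<kappa> p * dz i * dz j * dz k)"
    using B \<kappa> unfolding real_part_of_cubic_differential_def holomorphic_cubic_differential_def by blast
  have oc: "of_complex (to_complex y) = y" for y
    by (simp add: of_complex_def to_complex_def vec_eq_iff forall_2)
  have co: "to_complex (of_complex z) = z" for z
    by (simp add: of_complex_def to_complex_def)
  have "of_complex = (\<lambda>z. Re z *\<^sub>R axis 1 1 + Im z *\<^sub>R axis 2 1)"
    by (auto simp: of_complex_def vec_eq_iff forall_2 axis_2)
  moreover have "continuous_on UNIV (\<lambda>z. Re z *\<^sub>R axis 1 1 + Im z *\<^sub>R axis 2 1 :: real^2)"
    by (intro continuous_intros)
  ultimately have "continuous_on UNIV of_complex"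
    by (simp only:)
  then have "open (of_complex -` ?U)"
    using U open_vimage by blast
  \<comment> \<open>\<open>of_complex\<close> and \<open>to_complex\<close> are mutually inverse, so
    the complex image of the chart is the preimage of an open set under a continuous map.\<close>
  moreover have "of_complex -` ?U = ?V"
  proof (intro equalityI subsetI)
    fix z assume "z \<in> of_complex -` ?U"
    then have "to_complex (of_complex z) \<in> ?V"
      by (intro imageI) simp
    then show "z \<in> ?V"
      by (simp only: co)
  next
    fix z assume "z \<in> ?V"
    then obtain y where "y \<in> ?U" "z = to_complex y"
      by blast
    then show "z \<in> of_complex -` ?U"
      by (simp only: vimage_eq oc)
  qed
  ultimately have V: "open ?V"
    by simp
  have eq: "cubic_sq B \<kappa> (param \<kappa> y) = (cmod (Q \<kappa> (param \<kappa> (of_complex (to_complex y)))))\<^sup>2" if "y \<in> ?U" for y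
    using Q(2)[OF param_in[OF that]] by (simp add: cubic_sq_def dz_1 dz_2 oc cmod_power2)
  have "has_laplacian (\<lambda>y. ln ((cmod (Q \<kappa> (param \<kappa> (of_complex (to_complex y)))))\<^sup>2)) 0 x"
    using has_laplacian_ln_cmod_holomorphic[OF Q(1) V] nz x by (simp add: eq)
  moreover have "\<forall>\<^sub>F y in nhds x. ln ((cmod (Q \<kappa> (param \<kappa> (of_complex (to_complex y)))))\<^sup>2) =
      ln (cubic_sq B \<kappa> (param \<kappa> y))"
    using eventually_nhds_in_open[OF U x] by eventually_elim (simp add: eq)
  ultimately show ?thesis
    by (rule has_laplacian_cong)
qed

section \<open>Maxima on the compact surface\<close>

text \<open>Holomorphic charts cover the surface, so continuity in them makes \<open>G\<close>
  globally continuous, and compactness gives a maximum. The last conclusion restates it in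
  coordinates, where the Laplacian lives.\<close>

lemma maximum_in_holo_chart:
  fixes G :: "'a \<Rightarrow> real"
  assumes surface: "smooth_surface X A" "compact_space X" "topspace X \<noteq> {}"
    and J: "complex_structure X A J"
    and cont: "\<And>\<kappa>. \<kappa> \<in> A \<Longrightarrow> holo_chart J \<kappa> \<Longrightarrow> continuous_on (snd \<kappa> ` fst \<kappa>) (\<lambda>x. G (param \<kappa> x))"
  obtains \<kappa> x where "\<kappa> \<in> A" "holo_chart J \<kappa>" "x \<in> snd \<kappa> ` fst \<kappa>"
    "\<And>p. p \<in> topspace X \<Longrightarrow> G p \<le> G (param \<kappa> x)" "\<forall>\<^sub>F y in nhds x. G (param \<kappa> y) \<le> G (param \<kappa> x)"
proof -
  have chart: "is_chart X \<kappa>" if "\<kappa> \<in> A" for \<kappa>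
    using surface(1) that by (rule smooth_surface_chart)
  have local: "continuous_map (subtopology X (fst \<kappa>)) euclideanreal G" if "\<kappa> \<in> A" "holo_chart J \<kappa>" for \<kappa>
  proof -
    have "continuous_map (subtopology X (fst \<kappa>)) (top_of_set (snd \<kappa> ` fst \<kappa>)) (snd \<kappa>)"
      using chart[OF that(1)] homeomorphic_imp_continuous_map unfolding is_chart_def by blast
    moreover have "continuous_map (top_of_set (snd \<kappa> ` fst \<kappa>)) euclideanreal (\<lambda>x. G (param \<kappa> x))"
      using cont[OF that] by simp
    ultimately have "continuous_map (subtopology X (fst \<kappa>)) euclideanreal ((\<lambda>x. G (param \<kappa> x)) \<circ> snd \<kappa>)"
      by (rule continuous_map_compose)
    then show ?thesis
      by (rule continuous_map_eq) (use param_coordinate[OF chart[OF that(1)]] in auto)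
  qed
  have "openin X {p \<in> topspace X. G p \<in> W}" if W: "open W" for W
  proof (subst openin_subopen, intro ballI)
    fix p assume p: "p \<in> {p \<in> topspace X. G p \<in> W}"
    then obtain \<kappa> where \<kappa>: "\<kappa> \<in> A" "holo_chart J \<kappa>" "p \<in> fst \<kappa>"
      using J unfolding complex_structure_def by blast
    have op: "openin X (fst \<kappa>)"
      using chart[OF \<kappa>(1)] by (simp add: is_chart_def)
    then have "openin (subtopology X (fst \<kappa>)) {q \<in> topspace (subtopology X (fst \<kappa>)). G q \<in> W}"
      using W by (intro openin_continuous_map_preimage[OF local[OF \<kappa>(1,2)]]) simp
    then have "openin X {q \<in> topspace (subtopology X (fst \<kappa>)). G q \<in> W}"
      using op by (rule openin_trans_full)
    with p \<kappa>(3) show "\<exists>T. openin X T \<and> p \<in> T \<and> T \<subseteq> {p \<in> topspace X. G p \<in> W}"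
      by (intro exI[of _ "{q \<in> topspace (subtopology X (fst \<kappa>)). G q \<in> W}"]) auto
  qed
  then have "continuous_map X euclideanreal G"
    by (simp add: continuous_map_def)
  then have "compactin euclideanreal (G ` topspace X)"
    using surface(2) unfolding compact_space_def by (rule image_compactin[rotated])
  then have "compact (G ` topspace X)" "G ` topspace X \<noteq> {}"
    using surface(3) by auto
  then obtain p where p: "p \<in> topspace X" "\<And>q. q \<in> topspace X \<Longrightarrow> G q \<le> G p"
    using compact_attains_sup[of "G ` topspace X"] by blast
  from p(1) obtain \<kappa> where \<kappa>: "\<kappa> \<in> A" "holo_chart J \<kappa>" "p \<in> fst \<kappa>"
    using J unfolding complex_structure_def by blast
  have par: "param \<kappa> (snd \<kappa> p) = p"
    using chart[OF \<kappa>(1)] \<kappa>(3) by (rule param_coordinate)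
  have sub: "fst \<kappa> \<subseteq> topspace X"
    using chart[OF \<kappa>(1)] openin_subset unfolding is_chart_def by blast
  have "\<forall>\<^sub>F y in nhds (snd \<kappa> p). y \<in> snd \<kappa> ` fst \<kappa>"
    using is_chart_open[OF chart[OF \<kappa>(1)]] \<kappa>(3) by (intro eventually_nhds_in_open) auto
  then have "\<forall>\<^sub>F y in nhds (snd \<kappa> p). G (param \<kappa> y) \<le> G (param \<kappa> (snd \<kappa> p))"
  proof eventually_elim
    case (elim y)
    then have "param \<kappa> y \<in> topspace X"
      by (rule subsetD[OF sub param_in])
    then show ?case
      unfolding par by (rule p(2))
  qed
  moreover have "snd \<kappa> p \<in> snd \<kappa> ` fst \<kappa>"
    using \<kappa>(3) by (rule imageI)
  moreover have "G q \<le> G (param \<kappa> (snd \<kappa> p))" if "q \<in> topspace X" for q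
    unfolding par using that by (rule p(2))
  ultimately show thesis
    using that[OF \<kappa>(1,2)] by blast
qed

section \<open>Comparison of the metrics\<close>

lemma Psi_graph_metric:
  assumes "Psi_graph X A Or P C N h J B"
  shows "h \<in> C" "riemannian_metric A h" "determines_complex_structure X A Or C J"
    "complex_structure X A J"
  using assms by (auto simp: Psi_graph_def normalized_gauduchon_metric_def distinguished_metric_def
      einstein_AH_def AH_structure_def conformal_structure_def determines_complex_structure_def)

lemma Psi_graph_conformal_factor_pos:
  assumes "Psi_graph X A Or P C N h J B" "\<kappa> \<in> A" "holo_chart J \<kappa>" "p \<in> fst \<kappa>"
  shows "h \<kappa> p $ 1 $ 1 > 0"
  by (rule conformal_coordinates(2)[OF Psi_graph_metric(3,2,1)[OF assms(1)] assms(2-4)])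

lemma continuous_on_conformal_factor:
  assumes "Psi_graph X A Or P C N h J B" "\<kappa> \<in> A"
  shows "continuous_on (snd \<kappa> ` fst \<kappa>) (\<lambda>x. h \<kappa> (param \<kappa> x) $ 1 $ 1)"
proof -
  have "continuous_on (snd \<kappa> ` fst \<kappa>) (\<lambda>x. h \<kappa> (param \<kappa> x))"
    using Psi_graph_metric(2)[OF assms(1)] assms(2)
    by (intro smooth_on_continuous) (auto simp: riemannian_metric_def smooth_field_def)
  then show ?thesis
    by (intro continuous_intros)
qed

lemma continuous_on_cubic_sq:
  assumes "real_part_of_cubic_differential A J B" "\<kappa> \<in> A"
  shows "continuous_on (snd \<kappa> ` fst \<kappa>) (\<lambda>x. cubic_sq B \<kappa> (param \<kappa> x))"
proof -
  have "continuous_on (snd \<kappa> ` fst \<kappa>) (\<lambda>x. B \<kappa> (param \<kappa> x))"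
    using assms by (intro smooth_on_continuous)
      (auto simp: real_part_of_cubic_differential_def cubic_tensor_def smooth_field_def)
  then show ?thesis
    unfolding cubic_sq_def by (intro continuous_intros)
qed

text \<open>Scaling \<open>B\<close> by \<open>s\<close> multiplies \<open>|Q|^2\<close> by
  \<open>s\<close> squared, and the index symmetry of a cubic differential supplies the alignment
  relations.\<close>

lemma wang_equation:
  assumes "smooth_surface X A" "real_part_of_cubic_differential A J B"
    and "Psi_graph X A Or P C N h J (\<lambda>\<kappa> p. s *\<^sub>R B \<kappa> p)"
    and "\<kappa> \<in> A" "holo_chart J \<kappa>" "x \<in> snd \<kappa> ` fst \<kappa>"
  shows "has_laplacian (\<lambda>y. ln (h \<kappa> (param \<kappa> y) $ 1 $ 1))
    (2 * h \<kappa> (param \<kappa> x) $ 1 $ 1 - s\<^sup>2 * cubic_sq B \<kappa> (param \<kappa> x) / (h \<kappa> (param \<kappa> x) $ 1 $ 1)\<^sup>2) x"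
proof -
  have "(s *\<^sub>R B \<kappa> p) $ 2 $ 1 $ 1 = (s *\<^sub>R B \<kappa> p) $ 1 $ 1 $ 2 \<and> (s *\<^sub>R B \<kappa> p) $ 2 $ 1 $ 2 = (s *\<^sub>R B \<kappa> p) $ 1 $ 2 $ 2"
    if "p \<in> fst \<kappa>" for p
    using cubic_differential_components[OF assms(2,4,5) that] by simp
  from laplacian_ln_conformal_factor[OF assms(1,3-5) this assms(6)] show ?thesis
    by (simp add: cubic_sq_def power_mult_distrib distrib_left)
qed

text \<open>Since \<open>ln |Q|\<^sup>2\<close> is harmonic, the logarithm of the norm of the cubic differential has
  Laplacian \<open>-3\<close> times that of \<open>ln h\<^sub>1\<^sub>1\<close>.  The bound says that the Levi-Civita connection of
  the distinguished metric has nonpositive curvature.\<close>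

lemma cubic_sq_bound:
  assumes surface: "smooth_surface X A" "compact_space X"
    and B: "real_part_of_cubic_differential A J B"
    and Psi: "Psi_graph X A Or P C N h J (\<lambda>\<kappa> p. s *\<^sub>R B \<kappa> p)"
    and \<kappa>: "\<kappa> \<in> A" "holo_chart J \<kappa>" "p \<in> fst \<kappa>"
  shows "s\<^sup>2 * cubic_sq B \<kappa> p \<le> 2 * (h \<kappa> p $ 1 $ 1) ^ 3"
proof -
  note metric = Psi_graph_metric[OF Psi]
  note pos = Psi_graph_conformal_factor_pos[OF Psi]
  \<comment> \<open>The quotient is known chartwise only, so a holomorphic chart is picked at each
    point; by invariance the value does not depend on the pick.\<close>
  define ch where "ch = (\<lambda>p. SOME \<kappa>. \<kappa> \<in> A \<and> holo_chart J \<kappa> \<and> p \<in> fst \<kappa>)"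
  define F where "F = (\<lambda>p. cubic_sq B (ch p) p / (h (ch p) p $ 1 $ 1) ^ 3)"
  have F: "F p = cubic_sq B \<kappa> p / (h \<kappa> p $ 1 $ 1) ^ 3" if "\<kappa> \<in> A" "holo_chart J \<kappa>" "p \<in> fst \<kappa>" for \<kappa> p
  proof -
    have "ch p \<in> A \<and> holo_chart J (ch p) \<and> p \<in> fst (ch p)"
      unfolding ch_def by (rule someI[of _ \<kappa>]) (use that in blast)
    then show ?thesis
      unfolding F_def using that by (intro cubic_sq_norm_invariant[OF metric(3,2,1) B]) auto
  qed
  have pX: "p \<in> topspace X"
    using surface(1) \<kappa> unfolding smooth_surface_def by blast
  have cont: "continuous_on (snd \<kappa> ` fst \<kappa>) (\<lambda>x. F (param \<kappa> x))" if "\<kappa> \<in> A" "holo_chart J \<kappa>" for \<kappa>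
  proof -
    have "continuous_on (snd \<kappa> ` fst \<kappa>) (\<lambda>x. cubic_sq B \<kappa> (param \<kappa> x) / (h \<kappa> (param \<kappa> x) $ 1 $ 1) ^ 3)"
      using pos[OF that param_in]
      by (intro continuous_on_divide continuous_on_power continuous_on_cubic_sq[OF B that(1)]
          continuous_on_conformal_factor[OF Psi that(1)]) force
    then show ?thesis
      by (rule continuous_on_eq) (simp add: F[OF that param_in])
  qed
  obtain \<mu> x where \<mu>: "\<mu> \<in> A" "holo_chart J \<mu>" "x \<in> snd \<mu> ` fst \<mu>"
    and max: "\<And>p. p \<in> topspace X \<Longrightarrow> F p \<le> F (param \<mu> x)"
      "\<forall>\<^sub>F y in nhds x. F (param \<mu> y) \<le> F (param \<mu> x)"
    using maximum_in_holo_chart[OF surface _ metric(4) cont] pX by blast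
  let ?c = "\<lambda>y. h \<mu> (param \<mu> y) $ 1 $ 1" and ?b = "\<lambda>y. cubic_sq B \<mu> (param \<mu> y)"
  have U: "open (snd \<mu> ` fst \<mu>)"
    using surface(1) \<mu>(1) by (rule smooth_surface_open_image)
  have c: "?c y > 0" if "y \<in> snd \<mu> ` fst \<mu>" for y
    using pos[OF \<mu>(1,2) param_in[OF that]] .
  \<comment> \<open>If this failed at the maximum, \<open>?b x\<close> would be positive, so
    \<open>ln F\<close> would have a Laplacian at \<open>x\<close>, and its value
    \<open>-3 (2 c - s^2 b / c^2)\<close> would be positive.\<close>
  have "s\<^sup>2 * ?b x \<le> 2 * ?c x ^ 3"
  proof (rule ccontr)
    assume *: "\<not> ?thesis"
    moreover have "2 * ?c x ^ 3 > 0"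
      using c[OF \<mu>(3)] by simp
    ultimately have "s\<^sup>2 * ?b x > 0"
      by linarith
    then have b: "?b x > 0"
      by (simp add: zero_less_mult_iff)
    have "?b \<midarrow>x\<rightarrow> ?b x"
      using continuous_on_cubic_sq[OF B \<mu>(1)] U \<mu>(3) continuous_on_eq_continuous_at isCont_def by blast
    \<comment> \<open>Positivity is needed at nearby points too, so that the comparison passes from
      \<open>F\<close> to \<open>ln F\<close>.\<close>
    then have "\<forall>\<^sub>F y in nhds x. ?b y > 0"
      using b by (intro order_tendstoD(1)[OF tendsto_at_iff_tendsto_nhds[THEN iffD1]])
    with max(2) eventually_nhds_in_open[OF U \<mu>(3)]
    have "\<forall>\<^sub>F y in nhds x. 1 * ln (?b y) + (-3) * ln (?c y) \<le> 1 * ln (?b x) + (-3) * ln (?c x)"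
    proof eventually_elim
      case (elim y)
      have "ln (?b y / ?c y ^ 3) \<le> ln (?b x / ?c x ^ 3)"
        using elim c[of y] c[OF \<mu>(3)] b
        by (subst ln_le_cancel_iff) (simp_all add: F[OF \<mu>(1,2) param_in] \<mu>(3))
      then show ?case
        using elim(3) b c[OF elim(2)] c[OF \<mu>(3)] by (simp add: ln_div ln_realpow)
    qed
    moreover have "has_laplacian (\<lambda>y. 1 * ln (?b y) + (-3) * ln (?c y))
        (1 * 0 + (-3) * (2 * ?c x - s\<^sup>2 * ?b x / (?c x)\<^sup>2)) x"
      using b by (intro has_laplacian_lincomb ln_cubic_sq_harmonic[OF surface(1) B \<mu>]
          wang_equation[OF surface(1) B Psi \<mu>]) simp
    ultimately have "1 * 0 + (-3) * (2 * ?c x - s\<^sup>2 * ?b x / (?c x)\<^sup>2) \<le> 0"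
      by (rule has_laplacian_nonpos_at_max[rotated])
    with * c[OF \<mu>(3)] show False
      by (simp add: field_simps power2_eq_square power3_eq_cube)
  qed
  then have "s\<^sup>2 * F (param \<mu> x) \<le> 2"
    using c[OF \<mu>(3)] by (simp add: F[OF \<mu>(1,2) param_in[OF \<mu>(3)]] field_simps)
  moreover have "s\<^sup>2 * F p \<le> s\<^sup>2 * F (param \<mu> x)"
    using max(1)[OF pX] by (intro mult_left_mono) auto
  ultimately have "s\<^sup>2 * F p \<le> 2"
    by linarith
  then show ?thesis
    using pos[OF \<kappa>] by (simp add: F[OF \<kappa>] field_simps)
qed

section \<open>Monotonicity of the right hand side of Wang's equation\<close>

text \<open>A larger conformal factor raises the linear term and lowers the subtracted fraction; the
  smaller factor \<open>c\<close> carries the larger coefficient \<open>k\<close>, so the two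
  effects agree.\<close>

lemma wang_nonlinearity_mono:
  fixes a c b k l :: real
  assumes "0 < c" "c < a" "0 \<le> b" "0 \<le> l" "l \<le> k"
  shows "2 * c - k * b / c\<^sup>2 < 2 * a - l * b / a\<^sup>2"
proof -
  have "c\<^sup>2 \<le> a\<^sup>2"
    using assms by (intro power_mono) auto
  then have "l * b / a\<^sup>2 \<le> k * b / c\<^sup>2"
    using assms by (intro frac_le mult_right_mono mult_nonneg_nonneg) auto
  with assms(2) show ?thesis
    by linarith
qed

text \<open>At \<open>a = r * c\<close> the right side would be exactly \<open>r\<close> times the
  left one, which is nonnegative by the bound on \<open>b\<close>; passing to a larger
  \<open>a\<close> increases it strictly.\<close>

lemma wang_nonlinearity_scaled:
  fixes a c b r :: real
  assumes "0 < c" "1 < r" "r * c < a" "0 \<le> b" "b \<le> 2 * c ^ 3"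
  shows "2 * c - b / c\<^sup>2 < 2 * a - r ^ 3 * b / a\<^sup>2"
proof -
  have "r\<^sup>2 * c\<^sup>2 \<le> a\<^sup>2"
    using assms power_mono[of "r * c" a 2] by (simp add: power_mult_distrib)
  moreover have "0 < r * c"
    using assms by simp
  moreover from this have "0 < a"
    using assms(3) by linarith
  ultimately have "r ^ 3 * b / a\<^sup>2 \<le> r ^ 3 * b / (r\<^sup>2 * c\<^sup>2)"
    using assms by (intro divide_left_mono) auto
  also have "\<dots> = r * (b / c\<^sup>2)"
    using assms by (simp add: power2_eq_square power3_eq_cube)
  finally have 1: "r ^ 3 * b / a\<^sup>2 \<le> r * (b / c\<^sup>2)" .
  have "b / c\<^sup>2 \<le> 2 * c"
    using assms by (simp add: field_simps power2_eq_square power3_eq_cube)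
  then have "(r - 1) * (b / c\<^sup>2) \<le> (r - 1) * (2 * c)"
    using assms by (intro mult_left_mono) auto
  then have "r * (b / c\<^sup>2) - b / c\<^sup>2 \<le> 2 * (r * c) - 2 * c"
    by (simp only: left_diff_distrib mult_1 mult.left_commute)
  with 1 assms(3) show ?thesis
    by linarith
qed

theorem theorem9p2:
  fixes X :: "'a topology"
    and A Or :: "'a chart set"
    and g :: nat
    and J :: "('a, real^2^2) field"
    and B :: "('a, real^2^2^2) field"
    and P :: "real \<Rightarrow> ('a, real^2^2^2) field set"
    and C :: "real \<Rightarrow> ('a, real^2^2) field set"
    and N :: "real \<Rightarrow> ('a, real^2^2^2) field"
    and h :: "real \<Rightarrow> ('a, real^2^2) field"
    and \<phi> :: "real \<Rightarrow> 'a \<Rightarrow> real"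
  assumes surface: "smooth_surface X A" "compact_space X" "connected_space X"
    and oriented: "orientation X A Or"
    and genus: "has_genus X g" "g > 1"
    and J: "complex_structure X A J" "induces_orientation Or J"
    and B: "real_part_of_cubic_differential A J B"
    and B_nonzero: "\<exists>\<kappa>\<in>A. \<exists>p\<in>fst \<kappa>. B \<kappa> p \<noteq> 0"
    and einstein: "\<And>t. t \<ge> 0 \<Longrightarrow> einstein_AH X A (P t) (C t) (N t)"
    and gauduchon: "\<And>t. t \<ge> 0 \<Longrightarrow> normalized_gauduchon_metric A (C t) (N t) (h t)"
    and Psi: "\<And>t. t \<ge> 0 \<Longrightarrow>
      Psi_graph X A Or (P t) (C t) (N t) (h t) J (\<lambda>\<kappa> p. exp (3 * t) *\<^sub>R B \<kappa> p)"
    and conformal_factor: "\<And>t \<kappa> p. t \<ge> 0 \<Longrightarrow> \<kappa> \<in> A \<Longrightarrow> p \<in> fst \<kappa> \<Longrightarrow>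
      h t \<kappa> p = exp (\<phi> t p) *\<^sub>R h 1 \<kappa> p"
  shows "\<forall>p\<in>topspace X. mono_on {0<..} (\<lambda>t. \<phi> t p) \<and> 2-lipschitz_on {0<..} (\<lambda>t. \<phi> t p)"
proof -
  have pos: "h t \<kappa> p $ 1 $ 1 > 0" if "t \<ge> 0" "\<kappa> \<in> A" "holo_chart J \<kappa>" "p \<in> fst \<kappa>" for t \<kappa> p
    by (rule Psi_graph_conformal_factor_pos[OF Psi[OF that(1)] that(2-4)])
  have \<phi>: "\<phi> t p = ln (h t \<kappa> p $ 1 $ 1) - ln (h 1 \<kappa> p $ 1 $ 1)"
    if "t \<ge> 0" "\<kappa> \<in> A" "holo_chart J \<kappa>" "p \<in> fst \<kappa>" for t \<kappa> p
  proof -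
    have "h t \<kappa> p $ 1 $ 1 = exp (\<phi> t p) * h 1 \<kappa> p $ 1 $ 1"
      using conformal_factor[OF that(1,2,4)] by simp
    then show ?thesis
      using pos[of 1, OF _ that(2-4)] by (simp add: ln_mult)
  qed
  \<comment> \<open>At a maximum of the difference the background metric \<open>h 1\<close> cancels,
    and the maximum principle compares the two right hand sides. No order of \<open>s\<close> and
    \<open>t\<close> is assumed, as monotonicity and the Lipschitz bound use opposite
    differences.\<close>
  have diff_max: "\<exists>\<kappa>\<in>A. \<exists>p\<in>fst \<kappa>. holo_chart J \<kappa> \<and> (\<forall>q\<in>topspace X. \<phi> t q - \<phi> s q \<le> \<phi> t p - \<phi> s p) \<and>
      2 * h t \<kappa> p $ 1 $ 1 - exp (3 * t) ^ 2 * cubic_sq B \<kappa> p / (h t \<kappa> p $ 1 $ 1)\<^sup>2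
      \<le> 2 * h s \<kappa> p $ 1 $ 1 - exp (3 * s) ^ 2 * cubic_sq B \<kappa> p / (h s \<kappa> p $ 1 $ 1)\<^sup>2"
    if st: "s \<ge> 0" "t \<ge> 0" and ne: "topspace X \<noteq> {}" for s t
  proof -
    have diff: "\<phi> t p - \<phi> s p = 1 * ln (h t \<kappa> p $ 1 $ 1) + (-1) * ln (h s \<kappa> p $ 1 $ 1)"
      if "\<kappa> \<in> A" "holo_chart J \<kappa>" "p \<in> fst \<kappa>" for \<kappa> p
      by (simp add: \<phi>[OF st(1) that] \<phi>[OF st(2) that])
    have cont: "continuous_on (snd \<kappa> ` fst \<kappa>) (\<lambda>x. \<phi> t (param \<kappa> x) - \<phi> s (param \<kappa> x))"
      if \<kappa>: "\<kappa> \<in> A" "holo_chart J \<kappa>" for \<kappa>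
    proof -
      have ln: "continuous_on (snd \<kappa> ` fst \<kappa>) (\<lambda>x. ln (h r \<kappa> (param \<kappa> x) $ 1 $ 1))" if "r \<ge> 0" for r
        using pos[OF that \<kappa> param_in]
        by (intro continuous_on_ln continuous_on_conformal_factor[OF Psi[OF that] \<kappa>(1)]) force
      have "continuous_on (snd \<kappa> ` fst \<kappa>)
          (\<lambda>x. 1 * ln (h t \<kappa> (param \<kappa> x) $ 1 $ 1) + (-1) * ln (h s \<kappa> (param \<kappa> x) $ 1 $ 1))"
        by (intro continuous_intros ln st)
      then show ?thesis
        by (rule continuous_on_eq) (simp only: diff[OF \<kappa> param_in])
    qed
    obtain \<kappa> x where \<kappa>: "\<kappa> \<in> A" "holo_chart J \<kappa>" "x \<in> snd \<kappa> ` fst \<kappa>"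
      and max: "\<And>q. q \<in> topspace X \<Longrightarrow> \<phi> t q - \<phi> s q \<le> \<phi> t (param \<kappa> x) - \<phi> s (param \<kappa> x)"
        "\<forall>\<^sub>F y in nhds x. \<phi> t (param \<kappa> y) - \<phi> s (param \<kappa> y) \<le> \<phi> t (param \<kappa> x) - \<phi> s (param \<kappa> x)"
      using maximum_in_holo_chart[OF surface(1,2) ne J(1) cont] by blast
    let ?L = "\<lambda>r. 2 * h r \<kappa> (param \<kappa> x) $ 1 $ 1 -
      exp (3 * r) ^ 2 * cubic_sq B \<kappa> (param \<kappa> x) / (h r \<kappa> (param \<kappa> x) $ 1 $ 1)\<^sup>2"
    let ?u = "\<lambda>r y. ln (h r \<kappa> (param \<kappa> y) $ 1 $ 1)"
    have "has_laplacian (\<lambda>y. 1 * ?u t y + (-1) * ?u s y) (1 * ?L t + (-1) * ?L s) x"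
      by (intro has_laplacian_lincomb wang_equation[OF surface(1) B Psi \<kappa>] st)
    moreover have "\<forall>\<^sub>F y in nhds x. 1 * ?u t y + (-1) * ?u s y \<le> 1 * ?u t x + (-1) * ?u s x"
      using max(2) eventually_nhds_in_open[OF smooth_surface_open_image[OF surface(1) \<kappa>(1)] \<kappa>(3)]
      by eventually_elim (simp only: diff[OF \<kappa>(1,2) param_in] \<kappa>(3))
    ultimately have "1 * ?L t + (-1) * ?L s \<le> 0"
      by (rule has_laplacian_nonpos_at_max)
    then have "?L t \<le> ?L s"
      by (simp only: mult_1 mult_minus1 add_uminus_conv_diff diff_le_0_iff_le)
    with max(1) \<kappa>(1,2) param_in[OF \<kappa>(3)] show ?thesis
      by blast
  qed
  have b: "cubic_sq B \<kappa> p \<ge> 0" for \<kappa> p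
    by (simp add: cubic_sq_def)
  have mono: "\<phi> s q \<le> \<phi> t q" if st: "0 \<le> s" "s \<le> t" and q: "q \<in> topspace X" for s t q
  proof -
    have t: "0 \<le> t"
      using st by linarith
    obtain \<kappa> p where \<kappa>: "\<kappa> \<in> A" "holo_chart J \<kappa>" "p \<in> fst \<kappa>"
      and max: "\<phi> s q - \<phi> t q \<le> \<phi> s p - \<phi> t p"
      and L: "2 * h s \<kappa> p $ 1 $ 1 - exp (3 * s) ^ 2 * cubic_sq B \<kappa> p / (h s \<kappa> p $ 1 $ 1)\<^sup>2
      \<le> 2 * h t \<kappa> p $ 1 $ 1 - exp (3 * t) ^ 2 * cubic_sq B \<kappa> p / (h t \<kappa> p $ 1 $ 1)\<^sup>2"
      using diff_max[OF t st(1)] q by blast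
    have "exp (3 * s) ^ 2 \<le> exp (3 * t) ^ 2"
      using st by (intro power_mono) auto
    \<comment> \<open>Such an inequality at the maximum point of \<open>\<phi> s - \<phi> t\<close>
      would contradict \<open>L\<close>. The difference is then nonpositive at its maximum, hence
      everywhere.\<close>
    then have "\<not> h t \<kappa> p $ 1 $ 1 < h s \<kappa> p $ 1 $ 1"
      using wang_nonlinearity_mono[OF pos[OF t \<kappa>] _ b[of \<kappa> p] zero_le_power2] L
      by (meson not_le)
    then have "\<phi> s p \<le> \<phi> t p"
      using pos[OF t \<kappa>] pos[OF st(1) \<kappa>] by (simp add: \<phi>[OF t \<kappa>] \<phi>[OF st(1) \<kappa>])
    with max show ?thesis
      by linarith
  qed
  have lip: "\<phi> t q \<le> \<phi> s q + 2 * (t - s)" if st: "0 \<le> s" "s < t" and q: "q \<in> topspace X" for s t q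
  proof -
    have t: "0 \<le> t"
      using st by linarith
    obtain \<kappa> p where \<kappa>: "\<kappa> \<in> A" "holo_chart J \<kappa>" "p \<in> fst \<kappa>"
      and max: "\<phi> t q - \<phi> s q \<le> \<phi> t p - \<phi> s p"
      and L: "2 * h t \<kappa> p $ 1 $ 1 - exp (3 * t) ^ 2 * cubic_sq B \<kappa> p / (h t \<kappa> p $ 1 $ 1)\<^sup>2
      \<le> 2 * h s \<kappa> p $ 1 $ 1 - exp (3 * s) ^ 2 * cubic_sq B \<kappa> p / (h s \<kappa> p $ 1 $ 1)\<^sup>2"
      using diff_max[OF st(1) t] q by blast
    \<comment> \<open>From \<open>s\<close> to \<open>t\<close> the coefficient grows by
      \<open>exp (6 * (t - s))\<close>, which is \<open>r ^ 3\<close>, so \<open>h t\<close> is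
      compared with \<open>r\<close> times \<open>h s\<close>; \<open>ln r\<close> yields the
      Lipschitz constant 2.\<close>
    define r where "r = exp (2 * (t - s))"
    have r: "r > 1"
      using st by (simp add: r_def)
    have "exp (3 * t) ^ 2 = r ^ 3 * exp (3 * s) ^ 2"
      by (simp add: r_def flip: exp_of_nat_mult exp_add)
    then have L': "2 * h t \<kappa> p $ 1 $ 1 - r ^ 3 * (exp (3 * s) ^ 2 * cubic_sq B \<kappa> p) / (h t \<kappa> p $ 1 $ 1)\<^sup>2
      \<le> 2 * h s \<kappa> p $ 1 $ 1 - exp (3 * s) ^ 2 * cubic_sq B \<kappa> p / (h s \<kappa> p $ 1 $ 1)\<^sup>2"
      using L by (simp only: mult.assoc)
    have "0 \<le> exp (3 * s) ^ 2 * cubic_sq B \<kappa> p"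
      using b by simp
    \<comment> \<open>Otherwise the scaling inequality would contradict \<open>L'\<close>. The bound
      on the cubic differential for the metric \<open>h s\<close> enters here.\<close>
    then have "\<not> r * h s \<kappa> p $ 1 $ 1 < h t \<kappa> p $ 1 $ 1"
      using wang_nonlinearity_scaled[OF pos[OF st(1) \<kappa>] r _ _
          cubic_sq_bound[OF surface(1,2) B Psi[OF st(1)] \<kappa>]] L'
      by (meson not_le)
    then have "ln (h t \<kappa> p $ 1 $ 1) \<le> ln (r * h s \<kappa> p $ 1 $ 1)"
      using pos[OF t \<kappa>] by (intro ln_mono) auto
    also have "\<dots> = 2 * (t - s) + ln (h s \<kappa> p $ 1 $ 1)"
      using pos[OF st(1) \<kappa>] by (simp add: ln_mult r_def)
    finally have "\<phi> t p - \<phi> s p \<le> 2 * (t - s)"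
      by (simp add: \<phi>[OF t \<kappa>] \<phi>[OF st(1) \<kappa>])
    with max show ?thesis
      by linarith
  qed
  show ?thesis
  proof (intro ballI conjI)
    fix q assume q: "q \<in> topspace X"
    show "mono_on {0<..} (\<lambda>t. \<phi> t q)"
      using mono q by (intro mono_onI) auto
    show "2-lipschitz_on {0<..} (\<lambda>t. \<phi> t q)"
    proof (rule lipschitz_onI)
      fix s t :: real assume st: "s \<in> {0<..}" "t \<in> {0<..}"
      show "dist (\<phi> s q) (\<phi> t q) \<le> 2 * dist s t"
      \<comment> \<open>Monotonicity fixes the sign of the difference, so the one-sided bound
        \<open>lip\<close> controls its absolute value.\<close>
      proof (cases s t rule: linorder_cases)
        case less
        then show ?thesis
          using st mono[of s t q] lip[of s t q] q by (simp add: dist_real_def)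
      next
        case greater
        then show ?thesis
          using st mono[of t s q] lip[of t s q] q by (simp add: dist_real_def)
      qed simp
    qed simp
  qed
qed

end
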